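(* Let $I\subset S$ be a monomial ideal such that $S/I$ is Cohen–Macaulay and $I$ has codimension (height) $2$. Then $I$ is $0$-clean.
   Context: $S=K[x_1,\dots,x_n]$, $K$ a field. For a monomial $u=x_1^{a_1}\cdots x_n^{a_n}$, $\mathrm{supp}(u)=\{i:a_i>0\}$. For an ideal $I$, $\min(I)$ is the set of minimal primes of $I$. A monomial $u\neq 1$ with $u\notin I$ is a cleaner monomial of $I$ if $\min(I+Su)\subseteq\min(I)$. For $k\ge 0$, the class of $k$-clean monomial ideals is defined recursively (smallest class closed under the rule): a proper monomial ideal $I$ is $k$-clean if either $I$ is prime, or $I$ has no embedded primes and there is a cleaner monomial $u$ of $I$ with $|\mathrm{supp}(u)|\le k+1$ such that $I:u$ and $I+Su$ are $k$-clean. *)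

theory Defs
  imports "HOL-Library.Poly_Mapping" "HOL-Library.Extended_Nat"
begin

text \<open>Polynomials over a field K in the variables x_0, x_1, ... are represented as
  finitely supported maps from exponent vectors (monomials) to coefficients.
  The ring S = K[x_1,...,x_n] is the subring of polynomials only involving the
  variables with index < n (x_{i+1} of the paper is variable i here).\<close>

type_synonym 'a mpoly = "(nat \<Rightarrow>\<^sub>0 nat) \<Rightarrow>\<^sub>0 'a"

definition Spoly :: "nat \<Rightarrow> ('a::field) mpoly set" where
  "Spoly n = {p :: 'a mpoly. \<forall>m :: nat \<Rightarrow>\<^sub>0 nat \<in> Poly_Mapping.keys p. Poly_Mapping.keys m \<subseteq> {..<n}}"

definition monom :: "(nat \<Rightarrow>\<^sub>0 nat) \<Rightarrow> ('a::field) mpoly" where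
  "monom m = Poly_Mapping.single m 1"

definition is_monomial :: "nat \<Rightarrow> ('a::field) mpoly \<Rightarrow> bool" where
  "is_monomial n u \<longleftrightarrow> (\<exists>m. Poly_Mapping.keys m \<subseteq> {..<n} \<and> u = monom m)"

definition supp :: "('a::field) mpoly \<Rightarrow> nat set" where
  "supp u = Poly_Mapping.keys (THE m. u = monom m)"

definition is_ideal :: "nat \<Rightarrow> ('a::field) mpoly set \<Rightarrow> bool" where
  "is_ideal n I \<longleftrightarrow> I \<subseteq> Spoly n \<and> 0 \<in> I \<and> (\<forall>f\<in>I. \<forall>g\<in>I. f + g \<in> I)
     \<and> (\<forall>f\<in>I. \<forall>g\<in>Spoly n. g * f \<in> I)"

definition ideal_gen :: "nat \<Rightarrow> ('a::field) mpoly set \<Rightarrow> ('a::field) mpoly set" where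
  "ideal_gen n G = \<Inter>{J. is_ideal n J \<and> G \<subseteq> J}"

definition proper_ideal :: "nat \<Rightarrow> ('a::field) mpoly set \<Rightarrow> bool" where
  "proper_ideal n I \<longleftrightarrow> is_ideal n I \<and> 1 \<notin> I"

definition monomial_ideal :: "nat \<Rightarrow> ('a::field) mpoly set \<Rightarrow> bool" where
  "monomial_ideal n I \<longleftrightarrow> is_ideal n I \<and> I = ideal_gen n {u. is_monomial n u \<and> u \<in> I}"

definition prime_ideal :: "nat \<Rightarrow> ('a::field) mpoly set \<Rightarrow> bool" where
  "prime_ideal n P \<longleftrightarrow> proper_ideal n P \<and>
     (\<forall>a\<in>Spoly n. \<forall>b\<in>Spoly n. a * b \<in> P \<longrightarrow> a \<in> P \<or> b \<in> P)"

definition min_primes :: "nat \<Rightarrow> ('a::field) mpoly set \<Rightarrow> ('a::field) mpoly set set" where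
  "min_primes n I = {P. prime_ideal n P \<and> I \<subseteq> P \<and>
      (\<forall>Q. prime_ideal n Q \<and> I \<subseteq> Q \<and> Q \<subseteq> P \<longrightarrow> Q = P)}"

definition colon :: "nat \<Rightarrow> ('a::field) mpoly set \<Rightarrow> ('a::field) mpoly \<Rightarrow> ('a::field) mpoly set" where
  "colon n I f = {g \<in> Spoly n. g * f \<in> I}"

definition ass_primes :: "nat \<Rightarrow> ('a::field) mpoly set \<Rightarrow> ('a::field) mpoly set set" where
  "ass_primes n I = {P. prime_ideal n P \<and> (\<exists>f\<in>Spoly n. P = colon n I f)}"

definition no_embedded_primes :: "nat \<Rightarrow> ('a::field) mpoly set \<Rightarrow> bool" where
  "no_embedded_primes n I \<longleftrightarrow> ass_primes n I \<subseteq> min_primes n I"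

definition add_gen :: "nat \<Rightarrow> ('a::field) mpoly set \<Rightarrow> ('a::field) mpoly \<Rightarrow> ('a::field) mpoly set" where
  "add_gen n I u = ideal_gen n (insert u I)"

definition cleaner_monomial :: "nat \<Rightarrow> ('a::field) mpoly set \<Rightarrow> ('a::field) mpoly \<Rightarrow> bool" where
  "cleaner_monomial n I u \<longleftrightarrow> is_monomial n u \<and> u \<noteq> 1 \<and> u \<notin> I \<and>
     min_primes n (add_gen n I u) \<subseteq> min_primes n I"

inductive k_clean :: "nat \<Rightarrow> nat \<Rightarrow> ('a::field) mpoly set \<Rightarrow> bool" for n k where
  prime: "monomial_ideal n I \<Longrightarrow> proper_ideal n I \<Longrightarrow> prime_ideal n I \<Longrightarrow> k_clean n k I"
| step: "monomial_ideal n I \<Longrightarrow> proper_ideal n I \<Longrightarrow> no_embedded_primes n I \<Longrightarrow>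
     cleaner_monomial n I u \<Longrightarrow> card (supp u) \<le> k + 1 \<Longrightarrow>
     k_clean n k (colon n I u) \<Longrightarrow> k_clean n k (add_gen n I u) \<Longrightarrow> k_clean n k I"

definition prime_chain :: "nat \<Rightarrow> ('a::field) mpoly set list \<Rightarrow> bool" where
  "prime_chain n cs \<longleftrightarrow> cs \<noteq> [] \<and> (\<forall>P\<in>set cs. prime_ideal n P) \<and>
     (\<forall>i. Suc i < length cs \<longrightarrow> cs ! i \<subset> cs ! Suc i)"

definition prime_height :: "nat \<Rightarrow> ('a::field) mpoly set \<Rightarrow> enat" where
  "prime_height n P = Sup {enat (length cs - 1) | cs. prime_chain n cs \<and> last cs = P}"

definition height :: "nat \<Rightarrow> ('a::field) mpoly set \<Rightarrow> enat" where
  "height n I = Inf (prime_height n ` min_primes n I)"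

definition krull_dim_quot :: "nat \<Rightarrow> ('a::field) mpoly set \<Rightarrow> enat" where
  "krull_dim_quot n I = Sup {enat (length cs - 1) | cs. prime_chain n cs \<and> I \<subseteq> hd cs}"

definition max_ideal :: "nat \<Rightarrow> ('a::field) mpoly set" where
  "max_ideal n = {p \<in> Spoly n. Poly_Mapping.lookup p 0 = 0}"

definition regular_seq :: "nat \<Rightarrow> ('a::field) mpoly set \<Rightarrow> ('a::field) mpoly list \<Rightarrow> bool" where
  "regular_seq n I fs \<longleftrightarrow> set fs \<subseteq> max_ideal n \<and>
     1 \<notin> ideal_gen n (I \<union> set fs) \<and>
     (\<forall>i < length fs. \<forall>g\<in>Spoly n.
        g * fs ! i \<in> ideal_gen n (I \<union> set (take i fs)) \<longrightarrow> g \<in> ideal_gen n (I \<union> set (take i fs)))"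

definition depth_quot :: "nat \<Rightarrow> ('a::field) mpoly set \<Rightarrow> enat" where
  "depth_quot n I = Sup {enat (length fs) | fs. regular_seq n I fs}"

text \<open>S/I Cohen-Macaulay (I proper, graded): depth_m(S/I) = dim(S/I).\<close>
definition cohen_macaulay_quot :: "nat \<Rightarrow> ('a::field) mpoly set \<Rightarrow> bool" where
  "cohen_macaulay_quot n I \<longleftrightarrow> proper_ideal n I \<and> depth_quot n I = krull_dim_quot n I"

end

theory Submission
  imports Defs
begin

text \<open>
  Writing \<open>d = n - 2\<close>, a regular sequence of length \<open>d\<close> on \<open>S/I\<close> kills the Koszul homology of
  \<open>S/I\<close> in degree 3, since a nonzero class in degree 3 would climb to degree \<open>3 + d > n\<close>.
  Let \<open>V\<close> be a finite set of generators of \<open>I\<close>, and choose a minimal set \<open>E\<close> of edges on \<open>V\<close> such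
  that any \<open>u, v\<close> are joined by a path through generators dividing \<open>lcm(u, v)\<close>. The edges of \<open>E\<close>
  are minimal generators of the syzygies of \<open>V\<close>, and comparing the resolution with the Koszul
  complex, one multidegree at a time, shows that they satisfy no relation. So \<open>E\<close> is a tree, and
  a leaf \<open>u\<close> of it with neighbour \<open>p\<close> satisfies \<open>p | lcm(u, l)\<close> for all generators \<open>l \<noteq> u\<close>.

  If \<open>p\<close> divides \<open>u\<close>, then \<open>u\<close> is redundant. Otherwise some variable \<open>x\<close> has a smaller exponent
  in \<open>u\<close> than in \<open>p\<close>, hence than in every other generator; as the generators have no common
  variable, \<open>x\<close> does not divide \<open>u\<close>, and \<open>I + (x) = (x, u)\<close>. This is 0-clean, with associated
  primes generated by two variables, and \<open>I : x\<close> again has such a tree, obtained by lowering the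
  exponents of \<open>x\<close>. So \<open>x\<close> is a cleaner and induction applies; the associated primes of \<open>I\<close> are
  then all generated by two variables, hence minimal because \<open>I\<close> has height 2.
\<close>

section \<open>Koszul complexes\<close>

text \<open>What the regular sequence provides is Tor_3(S/I, K) = 0, and the combinatorics of the
  generators computes the same Tor. Edges linking \<open>V\<close> make S^E -> S^V -> I -> 0 exact.
  In multidegree b this complex is the boundary map of the graph of all generators and edges
  dividing x^b, so every argument about syzygies becomes one about paths and cycles in finite
  graphs. A relation among the edges is a cycle; minimality of the edge set keeps its coefficients
  in the maximal ideal, and the vanishing of Tor_3 then forces it to be zero by induction on the
  degree, as in Nakayama's lemma.

  The recursion for cleanness does not hand the Cohen-Macaulay property on to I : x. It works with a
  set of generators, possibly redundant, that has a tree, no common variable and no member 1. These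
  conditions are read off from exponent vectors, on which a colon by a variable acts by truncated
  subtraction. The shape of the associated primes is proved along with cleanness, because every step
  of the recursion has to exclude embedded primes.\<close>

definition koszul_sign :: "nat \<Rightarrow> nat set \<Rightarrow> 'r::comm_ring_1" where
  "koszul_sign j T = (- 1) ^ card {k \<in> T. k < j}"

text \<open>Chains are coefficient functions: \<open>z T\<close> is the coefficient of the exterior
  basis element e_T, so the boundary at T collects the coefficients of all supersets with one more
  index.\<close>

definition koszul_bd :: "nat set \<Rightarrow> (nat \<Rightarrow> 'r::comm_ring_1) \<Rightarrow> (nat set \<Rightarrow> 'r) \<Rightarrow> nat set \<Rightarrow> 'r" where
  "koszul_bd A a z T = (\<Sum>j\<in>A - T. koszul_sign j T * a j * z (insert j T))"

text \<open>Left multiplication by the exterior generator e_i.\<close>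

definition koszul_wedge :: "nat \<Rightarrow> (nat set \<Rightarrow> 'r::comm_ring_1) \<Rightarrow> nat set \<Rightarrow> 'r" where
  "koszul_wedge i z T = (if i \<in> T then koszul_sign i (T - {i}) * z (T - {i}) else 0)"

definition koszul_chain :: "nat set \<Rightarrow> nat \<Rightarrow> (nat set \<Rightarrow> 'r::comm_ring_1) \<Rightarrow> bool" where
  "koszul_chain A k z \<longleftrightarrow> (\<forall>T. z T \<noteq> 0 \<longrightarrow> T \<subseteq> A \<and> card T = k)"

lemma koszul_sign_insert:
  assumes "j \<notin> T"
  shows "koszul_sign k (insert j T) = (if j < k then - koszul_sign k T else koszul_sign k T)"
proof (cases "j < k")
  case True
  have "{l \<in> insert j T. l < k} = insert j {l \<in> T. l < k}"
    using True by auto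
  moreover have "finite {l \<in> T. l < k}"
    by (rule finite_subset[of _ "{..<k}"]) auto
  ultimately show ?thesis
    using True assms by (simp add: koszul_sign_def)
next
  case False
  then have "{l \<in> insert j T. l < k} = {l \<in> T. l < k}"
    by auto
  then show ?thesis
    using False by (simp add: koszul_sign_def)
qed

lemma koszul_sign_sq [simp]: "koszul_sign j T * koszul_sign j T = 1"
  by (simp add: koszul_sign_def flip: power_add mult_2)

lemma koszul_sign_sq_left [simp]: "koszul_sign j T * (koszul_sign j T * x) = x"
  by (simp add: mult.assoc[symmetric])

text \<open>Removing j and k in either order leads to the same coefficient, and only the sign of the
  larger index depends on whether the smaller one is present. The terms cancel in pairs.\<close>

lemma koszul_bd_koszul_bd:
  fixes a :: "nat \<Rightarrow> 'a::comm_ring_1"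
  assumes "finite A"
  shows "koszul_bd A a (koszul_bd A a z) T = 0"
proof -
  define F where "F j k = koszul_sign j T * a j * (koszul_sign k (insert j T) * a k * z (insert k (insert j T)))" for j k
  have anti: "F k j = - F j k" if "j < k" "j \<notin> T" "k \<notin> T" for j k
  proof -
    have "koszul_sign j (insert k T) = (koszul_sign j T :: 'a)" "koszul_sign k (insert j T) = - (koszul_sign k T :: 'a)"
      using that by (simp_all add: koszul_sign_insert)
    moreover have "insert j (insert k T) = insert k (insert j T)" by auto
    ultimately show ?thesis
      unfolding F_def by (simp only: mult_minus_left mult_minus_right minus_minus mult_ac)
  qed
  let ?B = "A - T"
  have "koszul_bd A a (koszul_bd A a z) T = (\<Sum>j\<in>?B. \<Sum>k\<in>?B - {j}. F j k)"
    unfolding koszul_bd_def F_def sum_distrib_left Diff_insert[of A _ T] by (rule refl)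
  also have "\<dots> = (\<Sum>j\<in>?B. (\<Sum>k\<in>{k\<in>?B. j < k}. F j k) + (\<Sum>k\<in>{k\<in>?B. k < j}. F j k))"
  proof (intro sum.cong refl)
    fix j assume "j \<in> ?B"
    have eq: "?B - {j} = {k\<in>?B. j < k} \<union> {k\<in>?B. k < j}" by auto
    show "(\<Sum>k\<in>?B - {j}. F j k) = (\<Sum>k\<in>{k\<in>?B. j < k}. F j k) + (\<Sum>k\<in>{k\<in>?B. k < j}. F j k)"
      unfolding eq by (rule sum.union_disjoint) (use assms in auto)
  qed
  also have "\<dots> = (\<Sum>j\<in>?B. \<Sum>k\<in>{k\<in>?B. j < k}. F j k) + (\<Sum>j\<in>?B. \<Sum>k\<in>{k\<in>?B. k < j}. F j k)"
    by (rule sum.distrib)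
  also have "(\<Sum>j\<in>?B. \<Sum>k\<in>{k\<in>?B. k < j}. F j k) = (\<Sum>k\<in>?B. \<Sum>j\<in>{j\<in>?B. k < j}. F j k)"
    by (rule sum.swap_restrict) (use assms in auto)
  also have "\<dots> = (\<Sum>k\<in>?B. \<Sum>j\<in>{j\<in>?B. k < j}. - F k j)"
  proof (intro sum.cong refl)
    fix k j assume "k \<in> ?B" "j \<in> {j \<in> ?B. k < j}"
    then show "F j k = - F k j" by (intro anti) simp_all
  qed
  finally show ?thesis
    unfolding sum_negf by (simp only: right_minus)
qed

text \<open>Wedging with e_i is a homotopy from multiplication by \<open>a i\<close> to zero. For
  \<open>a i = 1\<close> it turns every cycle into a boundary; for \<open>a i\<close> a variable it
  shows that the variable annihilates Koszul homology.\<close>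

lemma koszul_bd_koszul_wedge:
  assumes "finite A" "i \<in> A"
  shows "koszul_bd A a (koszul_wedge i z) T + koszul_wedge i (koszul_bd A a z) T = a i * z T"
proof (cases "i \<in> T")
  case False
  have "koszul_bd A a (koszul_wedge i z) T = (\<Sum>j\<in>A - T. if j = i then a i * z T else 0)"
    unfolding koszul_bd_def using False
    by (intro sum.cong) (auto simp: koszul_wedge_def mult_ac)
  also have "\<dots> = a i * z T"
    using assms False by (simp add: sum.delta')
  finally show ?thesis
    using False by (simp add: koszul_wedge_def)
next
  case True
  define U where "U = T - {i}"
  have T: "T = insert i U" "i \<notin> U"
    using True by (auto simp: U_def)
  have AU: "A - U = insert i (A - T)"
    using assms T by auto
  have "koszul_wedge i (koszul_bd A a z) T = koszul_sign i U * koszul_bd A a z U"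
    using T by (simp add: koszul_wedge_def)
  also have "koszul_bd A a z U = koszul_sign i U * a i * z T + (\<Sum>j\<in>A - T. koszul_sign j U * a j * z (insert j U))"
    unfolding koszul_bd_def AU using assms T by (subst sum.insert) auto
  finally have 1: "koszul_wedge i (koszul_bd A a z) T = a i * z T + (\<Sum>j\<in>A - T. koszul_sign i U * (koszul_sign j U * a j * z (insert j U)))"
    by (simp add: distrib_left mult.assoc sum_distrib_left)
  have "koszul_bd A a (koszul_wedge i z) T = (\<Sum>j\<in>A - T. - (koszul_sign i U * (koszul_sign j U * a j * z (insert j U))))"
    unfolding koszul_bd_def
  proof (intro sum.cong refl)
    fix j assume "j \<in> A - T"
    then have j: "j \<notin> U" "j \<noteq> i" using T by auto
    have eq: "insert j T - {i} = insert j U" using T j by auto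
    have "i < j \<or> j < i" using j by auto
    then show "koszul_sign j T * a j * koszul_wedge i z (insert j T) = - (koszul_sign i U * (koszul_sign j U * a j * z (insert j U)))"
      unfolding koszul_wedge_def eq unfolding T using j T(2)
      by (auto simp: koszul_sign_insert mult_ac)
  qed
  then show ?thesis
    using 1 by (simp add: sum_negf)
qed

lemma koszul_chain_koszul_wedge:
  assumes "koszul_chain A k z" "i \<in> A" "finite A"
  shows "koszul_chain A (Suc k) (koszul_wedge i z)"
  unfolding koszul_chain_def
proof (intro allI impI)
  fix T assume "koszul_wedge i z T \<noteq> 0"
  then have i: "i \<in> T" and "z (T - {i}) \<noteq> 0"
    by (auto simp: koszul_wedge_def split: if_splits)
  then have "T - {i} \<subseteq> A" "card (T - {i}) = k"
    using assms(1) unfolding koszul_chain_def by blast+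
  moreover have "finite T"
    using finite_subset[OF calculation(1) assms(3)] by simp
  ultimately show "T \<subseteq> A \<and> card T = Suc k"
    using i assms(2) card_Suc_Diff1[of T i] by (metis insert_Diff insert_subset)
qed

lemma koszul_chain_koszul_bd:
  assumes "koszul_chain A (Suc k) z" "finite A"
  shows "koszul_chain A k (koszul_bd A a z)"
  unfolding koszul_chain_def
proof (intro allI impI)
  fix T assume "koszul_bd A a z T \<noteq> 0"
  then obtain j where "j \<in> A - T" "z (insert j T) \<noteq> 0"
    unfolding koszul_bd_def by (metis (no_types, lifting) mult_zero_right sum.neutral)
  moreover from this have "insert j T \<subseteq> A" "card (insert j T) = Suc k"
    using assms by (auto simp: koszul_chain_def)
  moreover from calculation have "finite T"
    using assms finite_subset by (metis finite_insert)
  ultimately show "T \<subseteq> A \<and> card T = k" by auto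
qed

lemma koszul_bd_add: "koszul_bd A a (\<lambda>T. z T + w T) T = koszul_bd A a z T + koszul_bd A a w T"
  by (simp add: koszul_bd_def algebra_simps sum.distrib)

lemma koszul_bd_diff: "koszul_bd A a (\<lambda>T. z T - w T) T = koszul_bd A a z T - koszul_bd A a w T"
  by (simp add: koszul_bd_def algebra_simps sum_subtractf)

lemma koszul_bd_scale: "koszul_bd A a (\<lambda>T. c * z T) T = c * koszul_bd A a z T"
  by (simp add: koszul_bd_def sum_distrib_left algebra_simps)

lemma koszul_bd_sum: "koszul_bd A a (\<lambda>T. \<Sum>s\<in>S. z s T) T = (\<Sum>s\<in>S. koszul_bd A a (z s) T)"
  unfolding koszul_bd_def sum_distrib_left by (rule sum.swap)

lemma koszul_bd_zero [simp]: "koszul_bd A a (\<lambda>T. 0) T = 0"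
  by (simp add: koszul_bd_def)

section \<open>Graphs on a set of exponent vectors\<close>

text \<open>In a fixed multidegree the syzygy of an edge (u, v) becomes v - u once the monomial
  factors are dropped, so the map S^E -> S^V is the boundary map of a graph.\<close>

definition graph_bd :: "('v \<times> 'v) set \<Rightarrow> ('v \<times> 'v \<Rightarrow> 'r::comm_ring_1) \<Rightarrow> 'v \<Rightarrow> 'r" where
  "graph_bd E f v = (\<Sum>e\<in>E. f e * (of_bool (snd e = v) - of_bool (fst e = v)))"

definition inside :: "('v::ord \<times> 'v) set \<Rightarrow> 'v \<Rightarrow> ('v \<times> 'v) set" where
  "inside E c = {(u, v). ((u, v) \<in> E \<or> (v, u) \<in> E) \<and> u \<le> c \<and> v \<le> c}"

text \<open>The edges generate all syzygies: those of monomials are spanned by the ones of pairs,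
  and the pair syzygy of u and v, of degree lcm(u, v), is a sum along a path of edges whose degrees
  divide this lcm.\<close>

definition linked :: "'v::lattice set \<Rightarrow> ('v \<times> 'v) set \<Rightarrow> bool" where
  "linked V E \<longleftrightarrow> (\<forall>u\<in>V. \<forall>v\<in>V. (u, v) \<in> (inside E (sup u v))\<^sup>*)"

lemma inside_mono: "E \<subseteq> F \<Longrightarrow> (c::'v::order) \<le> d \<Longrightarrow> inside E c \<subseteq> inside F d"
  by (auto simp: inside_def)

lemma sym_inside_rtrancl: "sym ((inside E c)\<^sup>*)"
  by (rule sym_rtrancl) (auto simp: sym_def inside_def)

lemma linked_le:
  assumes "linked V E" "u \<in> V" "v \<in> V" "u \<le> c" "v \<le> c"
  shows "(u, v) \<in> (inside E c)\<^sup>*"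
proof -
  have "inside E (sup u v) \<subseteq> inside E c"
    using assms by (intro inside_mono) auto
  then show ?thesis
    using assms rtrancl_mono unfolding linked_def by blast
qed

lemma graph_bd_add: "graph_bd E (\<lambda>e. f e + g e) v = graph_bd E f v + graph_bd E g v"
  by (simp add: graph_bd_def distrib_right sum.distrib)

lemma graph_bd_diff: "graph_bd E (\<lambda>e. f e - g e) v = graph_bd E f v - graph_bd E g v"
  by (simp add: graph_bd_def left_diff_distrib sum_subtractf)

lemma graph_bd_sum: "graph_bd E (\<lambda>e. \<Sum>s\<in>S. f s e) v = (\<Sum>s\<in>S. graph_bd E (f s) v)"
  unfolding graph_bd_def sum_distrib_right by (rule sum.swap)

lemma graph_bd_scale: "graph_bd E (\<lambda>e. c * f e) v = c * graph_bd E f v"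
  by (simp add: graph_bd_def sum_distrib_left mult.assoc)

lemma graph_bd_single:
  assumes "finite E" "a \<in> E"
  shows "graph_bd E (\<lambda>e. of_bool (e = a)) v = of_bool (snd a = v) - of_bool (fst a = v)"
proof -
  have "graph_bd E (\<lambda>e. of_bool (e = a)) v
    = (\<Sum>e\<in>E. if e = a then of_bool (snd a = v) - of_bool (fst a = v) else 0)"
    unfolding graph_bd_def by (rule sum.cong) auto
  also have "\<dots> = of_bool (snd a = v) - of_bool (fst a = v)"
    using assms by simp
  finally show ?thesis .
qed

text \<open>An edge may be traversed in either direction; a backward step contributes -1, and
  repeated visits add up.\<close>

lemma path_chain:
  assumes "(u, v) \<in> (inside E c)\<^sup>*" "finite E"
  shows "\<exists>f :: _ \<Rightarrow> 'r::comm_ring_1. (\<forall>e. f e \<noteq> 0 \<longrightarrow> e \<in> E \<and> fst e \<le> c \<and> snd e \<le> c) \<and>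
    (\<forall>w. graph_bd E f w = of_bool (v = w) - of_bool (u = w))"
  using assms(1)
proof (induction rule: rtrancl_induct)
  case base
  show ?case by (rule exI[of _ "\<lambda>_. 0"]) (simp add: graph_bd_def)
next
  case (step v x)
  then obtain f :: "_ \<Rightarrow> 'r" where f: "\<And>e. f e \<noteq> 0 \<Longrightarrow> e \<in> E \<and> fst e \<le> c \<and> snd e \<le> c"
    "\<And>w. graph_bd E f w = of_bool (v = w) - of_bool (u = w)" by blast
  show ?case
  proof (cases "(v, x) \<in> E")
    case True
    show ?thesis
    proof (rule exI[of _ "\<lambda>e. f e + of_bool (e = (v, x))"], intro conjI allI impI)
      fix e assume "f e + of_bool (e = (v, x)) \<noteq> 0"
      then have "f e \<noteq> 0 \<or> e = (v, x)" by auto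
      then show "e \<in> E" "fst e \<le> c" "snd e \<le> c"
        using f(1)[of e] True step(2) by (auto simp: inside_def)
    qed (use True in \<open>simp add: graph_bd_add f(2) graph_bd_single assms(2)\<close>)
  next
    case False
    then have E: "(x, v) \<in> E" using step(2) by (auto simp: inside_def)
    show ?thesis
    proof (rule exI[of _ "\<lambda>e. f e - of_bool (e = (x, v))"], intro conjI allI impI)
      fix e assume "f e - of_bool (e = (x, v)) \<noteq> 0"
      then have "f e \<noteq> 0 \<or> e = (x, v)" by auto
      then show "e \<in> E" "fst e \<le> c" "snd e \<le> c"
        using f(1)[of e] E step(2) by (auto simp: inside_def)
    qed (use E in \<open>simp add: graph_bd_diff f(2) graph_bd_single assms(2)\<close>)
  qed
qed

text \<open>With total sum zero, s is the combination of the differences v - u with weights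
  \<open>s v\<close>, for a fixed u in its support. Each difference is filled by a path, which stays
  inside c because both of its ends divide x^c.\<close>

lemma graph_bd_fill:
  fixes s :: "'v::lattice \<Rightarrow> 'r::comm_ring_1"
  assumes "finite V" "finite E" "linked V E"
    and s: "\<And>v. s v \<noteq> 0 \<Longrightarrow> v \<in> V \<and> v \<le> c" and "sum s V = 0"
  shows "\<exists>t. (\<forall>e. t e \<noteq> 0 \<longrightarrow> e \<in> E \<and> fst e \<le> c \<and> snd e \<le> c) \<and> (\<forall>v. graph_bd E t v = s v)"
proof (cases "\<forall>v. s v = 0")
  case True
  then show ?thesis by (intro exI[of _ "\<lambda>_. 0"]) (simp add: graph_bd_def)
next
  case False
  then obtain u where u: "s u \<noteq> 0" by blast
  define W where "W = {v \<in> V. v \<le> c}"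
  have W: "finite W" using assms(1) by (simp add: W_def)
  have sW: "sum s W = 0"
  proof -
    have "sum s V = sum s W"
      by (rule sum.mono_neutral_right[OF assms(1)]) (use s in \<open>auto simp: W_def\<close>)
    then show ?thesis using assms(5) by simp
  qed
  have "\<forall>v. \<exists>f :: _ \<Rightarrow> 'r. v \<in> W \<longrightarrow> (\<forall>e. f e \<noteq> 0 \<longrightarrow> e \<in> E \<and> fst e \<le> c \<and> snd e \<le> c) \<and>
    (\<forall>w. graph_bd E f w = of_bool (v = w) - of_bool (u = w))"
    using path_chain[OF linked_le[OF assms(3), of u _ c] assms(2)] s[OF u] unfolding W_def by blast
  then obtain \<phi> :: "'v \<Rightarrow> 'v \<times> 'v \<Rightarrow> 'r" where
    phi: "\<And>v e. v \<in> W \<Longrightarrow> \<phi> v e \<noteq> 0 \<Longrightarrow> e \<in> E \<and> fst e \<le> c \<and> snd e \<le> c"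
    "\<And>v w. v \<in> W \<Longrightarrow> graph_bd E (\<phi> v) w = of_bool (v = w) - of_bool (u = w)"
    by metis
  show ?thesis
  proof (intro exI[of _ "\<lambda>e. \<Sum>v\<in>W. s v * \<phi> v e"] conjI allI impI)
    fix e assume "(\<Sum>v\<in>W. s v * \<phi> v e) \<noteq> 0"
    then obtain v where "v \<in> W" "\<phi> v e \<noteq> 0"
      by (metis (no_types, lifting) mult_zero_right sum.neutral)
    then show "e \<in> E" "fst e \<le> c" "snd e \<le> c" using phi(1) by blast+
  next
    fix w
    have "graph_bd E (\<lambda>e. \<Sum>v\<in>W. s v * \<phi> v e) w = (\<Sum>v\<in>W. s v * of_bool (v = w)) - (\<Sum>v\<in>W. s v) * of_bool (u = w)"
      unfolding graph_bd_sum graph_bd_scale sum_distrib_right sum_subtractf[symmetric]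
      by (rule sum.cong) (simp_all add: phi(2) right_diff_distrib)
    also have "(\<Sum>v\<in>W. s v * of_bool (v = w)) = (\<Sum>v\<in>W. if v = w then s w else 0)"
      by (rule sum.cong) auto
    also have "\<dots> = s w"
    proof (cases "w \<in> W")
      case True
      then show ?thesis using W by simp
    next
      case False
      then have "s w = 0" using s[of w] by (auto simp: W_def)
      then show ?thesis by (simp cong: if_cong)
    qed
    finally show "graph_bd E (\<lambda>e. \<Sum>v\<in>W. s v * \<phi> v e) w = s w" by (simp add: sW)
  qed
qed

text \<open>Summing the boundary over the component of u in the graph without the edge counts every
  other edge with both ends or with neither. If v lay outside, only the coefficient of (u, v) would
  remain.\<close>

lemma cycle_edge_not_bridge:
  fixes \<rho> :: "'v::order \<times> 'v \<Rightarrow> 'r::comm_ring_1"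
  assumes "finite E"
    and supp: "\<And>e. \<rho> e \<noteq> 0 \<Longrightarrow> e \<in> E \<and> fst e \<le> c \<and> snd e \<le> c"
    and cyc: "\<And>w. graph_bd E \<rho> w = 0" and "\<rho> (u, v) \<noteq> 0"
  shows "(u, v) \<in> (inside (E - {(u, v)}) c)\<^sup>*"
proof (rule ccontr)
  assume not: "(u, v) \<notin> (inside (E - {(u, v)}) c)\<^sup>*"
  let ?R = "(inside (E - {(u, v)}) c)\<^sup>*"
  define W where "W = {w \<in> fst ` E \<union> snd ` E. (u, w) \<in> ?R}"
  have W: "finite W" using assms(1) by (simp add: W_def)
  have uv: "(u, v) \<in> E" "u \<le> c" "v \<le> c" using supp[OF assms(4)] by auto
  have other: "\<rho> e * (of_bool (snd e \<in> W) - of_bool (fst e \<in> W)) = 0" if "e \<in> E" "e \<noteq> (u, v)" for e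
  proof (cases "\<rho> e = 0")
    case False
    obtain a b where ab: "e = (a, b)" by force
    have "a \<le> c" "b \<le> c" using supp[OF False] ab by auto
    then have *: "(a, b) \<in> inside (E - {(u, v)}) c" "(b, a) \<in> inside (E - {(u, v)}) c"
      using that unfolding ab inside_def by blast+
    have "a \<in> fst ` E \<union> snd ` E" "b \<in> fst ` E \<union> snd ` E"
      using that(1) ab by force+
    moreover have "(u, a) \<in> ?R \<longleftrightarrow> (u, b) \<in> ?R"
      using * by (meson rtrancl_into_rtrancl)
    ultimately have "fst e \<in> W \<longleftrightarrow> snd e \<in> W"
      unfolding W_def ab by simp
    then show ?thesis by simp
  qed simp
  have "0 = (\<Sum>w\<in>W. graph_bd E \<rho> w)" by (simp add: cyc)
  also have "\<dots> = (\<Sum>e\<in>E. \<Sum>w\<in>W. \<rho> e * (of_bool (snd e = w) - of_bool (fst e = w)))"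
    unfolding graph_bd_def by (rule sum.swap)
  also have "\<dots> = (\<Sum>e\<in>E. \<rho> e * (of_bool (snd e \<in> W) - of_bool (fst e \<in> W)))"
    using W by (intro sum.cong refl)
      (simp add: sum_distrib_left[symmetric] sum_subtractf of_bool_def)
  also have "\<dots> = (\<Sum>e\<in>{(u, v)}. \<rho> e * (of_bool (snd e \<in> W) - of_bool (fst e \<in> W)))"
    using assms(1) uv other by (intro sum.mono_neutral_right) auto
  also have "\<dots> = - \<rho> (u, v)"
  proof -
    have "u \<in> W" "v \<notin> W" using uv not by (force simp: W_def)+
    then show ?thesis by simp
  qed
  finally show False using assms(4) by simp
qed

text \<open>A path through the edge can take the detour instead: the detour stays below lcm(u, v),
  hence below every bound under which the edge itself was available.\<close>

lemma linked_remove_edge: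
  assumes "linked V E" "(u, v) \<in> (inside (E - {(u, v)}) (sup u v))\<^sup>*"
  shows "linked V (E - {(u, v)})"
  unfolding linked_def
proof (intro ballI)
  fix x y assume "x \<in> V" "y \<in> V"
  let ?c = "sup x y" and ?F = "E - {(u, v)}"
  have "inside E ?c \<subseteq> (inside ?F ?c)\<^sup>*"
  proof
    fix p assume p: "p \<in> inside E ?c"
    obtain a b where ab: "p = (a, b)" by force
    show "p \<in> (inside ?F ?c)\<^sup>*"
    proof (cases "p \<in> inside ?F ?c")
      case False
      then have *: "(a, b) = (u, v) \<or> (b, a) = (u, v)" using p ab by (auto simp: inside_def)
      then have "sup u v \<le> ?c" using p ab by (auto simp: inside_def)
      then have "(u, v) \<in> (inside ?F ?c)\<^sup>*"
        using assms(2) rtrancl_mono[OF inside_mono[of ?F ?F "sup u v" ?c]] by blast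
      then show ?thesis
        using * ab sym_inside_rtrancl[of ?F ?c] by (auto simp: sym_def)
    qed auto
  qed
  then have "(inside E ?c)\<^sup>* \<subseteq> (inside ?F ?c)\<^sup>*"
    by (metis rtrancl_idemp rtrancl_mono)
  then show "(x, y) \<in> (inside ?F ?c)\<^sup>*"
    using assms(1) \<open>x \<in> V\<close> \<open>y \<in> V\<close> unfolding linked_def by blast
qed

lemma minimal_linked:
  assumes "finite V"
  shows "\<exists>E. E \<subseteq> V \<times> V \<and> linked V E \<and> (\<forall>e\<in>E. \<not> linked V (E - {e}))"
proof -
  have "linked V (V \<times> V)"
    by (auto simp: linked_def inside_def intro!: r_into_rtrancl)
  then have "V \<times> V \<subseteq> V \<times> V \<and> linked V (V \<times> V)" by simp
  from ex_has_least_nat[where P = "\<lambda>E. E \<subseteq> V \<times> V \<and> linked V E", OF this, of card]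
  obtain E where least: "(E \<subseteq> V \<times> V \<and> linked V E) \<and>
      (\<forall>F. F \<subseteq> V \<times> V \<and> linked V F \<longrightarrow> card E \<le> card F)"
    by (rule exE)
  have E: "E \<subseteq> V \<times> V" "linked V E"
    and min: "\<And>F. F \<subseteq> V \<times> V \<Longrightarrow> linked V F \<Longrightarrow> card E \<le> card F"
    using least by simp_all
  have "finite E" using finite_subset[OF E(1)] assms by simp
  have "\<not> linked V (E - {e})" if "e \<in> E" for e
  proof
    assume "linked V (E - {e})"
    then have "card E \<le> card (E - {e})" using E(1) by (intro min) auto
    then show False using card_Diff1_less[OF \<open>finite E\<close> that] by simp
  qed
  then show ?thesis using E by blast
qed

section \<open>Cycles and Koszul homology\<close>

text \<open>For v dividing x^b these are the variables dividing x^b / v. Their subsets index the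
  Koszul basis of the summand of S^V belonging to v, in multidegree b.\<close>

definition slack :: "(nat \<Rightarrow> nat) \<Rightarrow> (nat \<Rightarrow> nat) \<Rightarrow> nat set" where
  "slack v b = {i. v i < b i}"

definition covered :: "(nat \<Rightarrow> nat) set \<Rightarrow> (nat \<Rightarrow> nat) \<Rightarrow> nat set \<Rightarrow> bool" where
  "covered V b T \<longleftrightarrow> (\<exists>v\<in>V. v \<le> b \<and> T \<subseteq> slack v b)"

text \<open>For \<open>T \<subseteq> supp b\<close>, \<open>covered V b T\<close> means that \<open>x\<^sup>b / (\<Prod>i\<in>T. x\<^sub>i)\<close> lies in the ideal
  generated by \<open>V\<close>. The next definition is the vanishing of the Koszul homology of the quotient by
  this ideal in homological degree 3 and multidegree \<open>b\<close>.\<close>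

definition koszul_vanishing :: "'r::comm_ring_1 itself \<Rightarrow> (nat \<Rightarrow> nat) set \<Rightarrow> (nat \<Rightarrow> nat) \<Rightarrow> bool" where
  "koszul_vanishing _ V b \<longleftrightarrow> (\<forall>y :: nat set \<Rightarrow> 'r. koszul_chain {i. 0 < b i} 3 y \<longrightarrow>
     (\<forall>U. U \<subseteq> {i. 0 < b i} \<longrightarrow> card U = 2 \<longrightarrow> \<not> covered V b U \<longrightarrow> koszul_bd {i. 0 < b i} (\<lambda>_. 1) y U = 0) \<longrightarrow>
     (\<exists>w. koszul_chain {i. 0 < b i} 4 w \<and>
       (\<forall>T. T \<subseteq> {i. 0 < b i} \<longrightarrow> card T = 3 \<longrightarrow> \<not> covered V b T \<longrightarrow> y T = koszul_bd {i. 0 < b i} (\<lambda>_. 1) w T)))"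

lemma slack_subset: "slack v b \<subseteq> {i. 0 < b i}"
  by (auto simp: slack_def)

lemma graph_bd_koszul_bd_commute:
  "graph_bd E (\<lambda>e. koszul_bd A a (f e) T) v = koszul_bd A a (\<lambda>T. graph_bd E (\<lambda>e. f e T) v) T"
proof -
  have "graph_bd E (\<lambda>e. koszul_bd A a (f e) T) v
    = (\<Sum>e\<in>E. koszul_bd A a (\<lambda>T. f e T * (of_bool (snd e = v) - of_bool (fst e = v))) T)"
    unfolding graph_bd_def by (rule sum.cong) (simp_all add: koszul_bd_def sum_distrib_right mult.assoc)
  also have "\<dots> = koszul_bd A a (\<lambda>T. graph_bd E (\<lambda>e. f e T) v) T"
    unfolding graph_bd_def by (rule koszul_bd_sum[symmetric])
  finally show ?thesis .
qed

lemma koszul_bd_eq_0: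
  assumes "\<And>j. j \<in> A \<Longrightarrow> j \<notin> T \<Longrightarrow> z (insert j T) = 0"
  shows "koszul_bd A a z T = 0"
  unfolding koszul_bd_def by (rule sum.neutral) (simp add: assms)

lemma sum_graph_bd:
  assumes "finite V" "E \<subseteq> V \<times> V"
  shows "(\<Sum>v\<in>V. graph_bd E f v) = 0"
proof -
  have "(\<Sum>v\<in>V. graph_bd E f v) = (\<Sum>e\<in>E. \<Sum>v\<in>V. f e * (of_bool (snd e = v) - of_bool (fst e = v)))"
    unfolding graph_bd_def by (rule sum.swap)
  also have "\<dots> = (\<Sum>e\<in>E. 0)"
    using assms by (intro sum.cong refl)
      (auto simp: sum_distrib_left[symmetric] sum_subtractf of_bool_def)
  finally show ?thesis by simp
qed

text \<open>A chase through the double complex with the Koszul complex in one direction and S^E ->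
  S^V -> S in the other, all in multidegree b. The cycle r is carried from Koszul degree 0 over S^E
  to degree 3 over S, where the vanishing hypothesis corrects the element. The way back shows that r
  is the boundary of a chain which, up to a boundary, consists of cycles of smaller degree; these
  vanish by induction.\<close>

lemma cycle_vanishes_below:
  fixes r :: "(nat \<Rightarrow> nat) \<times> (nat \<Rightarrow> nat) \<Rightarrow> 'r::comm_ring_1"
  assumes finV: "finite V" and E: "E \<subseteq> V \<times> V" "linked V E" and min: "\<And>e. e \<in> E \<Longrightarrow> \<not> linked V (E - {e})"
    and van: "\<And>b. {i. 0 < b i} \<subseteq> N \<Longrightarrow> koszul_vanishing TYPE('r) V b" and N: "finite N"
    and b: "{i. 0 < b i} \<subseteq> N"
    and supp: "\<And>e. r e \<noteq> 0 \<Longrightarrow> e \<in> E \<and> fst e \<le> b \<and> snd e \<le> b"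
    and cyc: "\<And>v. graph_bd E r v = 0"
  shows "r e = 0"
  using b supp cyc
proof (induction "\<Sum>i\<in>N. b i" arbitrary: b r e rule: less_induct)
  case less
  note b = less.prems(1) and supp = less.prems(2) and cyc = less.prems(3)
  have finE: "finite E" using E finV finite_subset by blast
  define B where "B = {i. 0 < b i}"
  have finB: "finite B" using b N finite_subset unfolding B_def by blast
  define S where "S e = slack (fst e) b \<inter> slack (snd e) b" for e
  have SB: "slack v b \<subseteq> B" for v using slack_subset B_def by simp
  \<comment> \<open>If no variable is slack at both ends of an edge of the support, then x^b is the
    lcm of the ends. The cycle then provides a detour below this lcm, against the minimality of E.
    So r has no unit coefficients.\<close>
  have top: "r e = 0" if "S e = {}" for e
  proof (rule ccontr)
    assume ne: "r e \<noteq> 0"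
    obtain u v where uv: "e = (u, v)" by force
    have *: "(u, v) \<in> E" "u \<le> b" "v \<le> b" using supp[OF ne] uv by auto
    have "b i \<le> max (u i) (v i)" for i
    proof -
      have "\<not> (u i < b i \<and> v i < b i)"
        using that unfolding uv S_def slack_def by auto
      then show ?thesis by linarith
    qed
    then have "b \<le> sup u v" by (auto simp: le_fun_def sup_max)
    then have "b = sup u v" using * by (simp add: antisym)
    moreover have "(u, v) \<in> (inside (E - {(u, v)}) b)\<^sup>*"
      by (rule cycle_edge_not_bridge[OF finE supp cyc]) (use ne uv in auto)
    ultimately show False
      using min[OF *(1)] linked_remove_edge[OF E(2)] by blast
  qed
  define \<iota> where "\<iota> e = (SOME i. i \<in> S e)" for e
  have iota: "\<iota> e \<in> S e" if "r e \<noteq> 0" for e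
    using top[of e] that some_in_eq[of "S e"] unfolding \<iota>_def by blast
  \<comment> \<open>A preimage of r under the Koszul boundary, concentrated for each edge in one
    index at which both ends leave room.\<close>
  define \<rho> where "\<rho> e T = (if T = {\<iota> e} then r e else 0)" for e T
  have rho_bd: "koszul_bd B (\<lambda>_. 1) (\<rho> e) {} = r e" for e
  proof (cases "r e = 0")
    case True
    then show ?thesis by (simp add: \<rho>_def koszul_bd_def cong: if_cong)
  next
    case False
    then have "\<iota> e \<in> B" using iota[of e] SB by (auto simp: S_def)
    have "koszul_bd B (\<lambda>_. 1) (\<rho> e) {} = (\<Sum>j\<in>B. if j = \<iota> e then r e else 0)"
      unfolding koszul_bd_def by (rule sum.cong) (auto simp: \<rho>_def koszul_sign_def)
    then show ?thesis using finB \<open>\<iota> e \<in> B\<close> by simp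
  qed
  \<comment> \<open>Koszul degree 1 over S^V. This is a Koszul cycle because r is a graph
    cycle.\<close>
  define \<delta> where "\<delta> v T = graph_bd E (\<lambda>e. \<rho> e T) v" for v T
  have delta_supp: "v \<in> V \<and> v \<le> b \<and> (\<exists>i\<in>slack v b. T = {i})" if dne: "\<delta> v T \<noteq> 0" for v T
  proof -
    obtain e where e: "e \<in> E" "\<rho> e T * (of_bool (snd e = v) - of_bool (fst e = v)) \<noteq> 0"
      using sum.not_neutral_contains_not_neutral[OF dne[unfolded \<delta>_def graph_bd_def]] by blast
    then have *: "\<rho> e T \<noteq> 0" "v = fst e \<or> v = snd e" by (fastforce simp: of_bool_def split: if_splits)+
    then have **: "r e \<noteq> 0" "T = {\<iota> e}" by (auto simp: \<rho>_def split: if_splits)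
    then have "\<iota> e \<in> slack v b" using iota[of e] *(2) by (auto simp: S_def)
    moreover have "v \<in> V" "v \<le> b" using supp[OF **(1)] *(2) E(1) by auto
    ultimately show ?thesis using **(2) by blast
  qed
  have delta_cyc: "koszul_bd B (\<lambda>_. 1) (\<delta> v) T = 0" for v T
  proof (cases "T = {}")
    case True
    have "koszul_bd B (\<lambda>_. 1) (\<delta> v) T = graph_bd E (\<lambda>e. koszul_bd B (\<lambda>_. 1) (\<rho> e) T) v"
      unfolding graph_bd_koszul_bd_commute \<delta>_def ..
    also have "\<dots> = graph_bd E r v" unfolding True rho_bd ..
    finally show ?thesis using cyc by simp
  next
    case False
    show ?thesis
    proof (rule koszul_bd_eq_0, rule ccontr)
      fix j assume "j \<notin> T" "\<delta> v (insert j T) \<noteq> 0"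
      then obtain i where "insert j T = {i}" using delta_supp by blast
      then show False using False \<open>j \<notin> T\<close> by auto
    qed
  qed
  \<comment> \<open>A filling of \<open>\<delta> v\<close> in Koszul degree 2. The wedge index is
    taken from \<open>slack v b\<close> so that the result stays in the summand of v; without such
    an index \<open>\<delta> v\<close> is zero.\<close>
  define \<mu> where "\<mu> v = (if slack v b = {} then (\<lambda>_. 0) else koszul_wedge (SOME i. i \<in> slack v b) (\<delta> v))" for v
  have mu_supp: "v \<in> V \<and> v \<le> b \<and> T \<subseteq> slack v b \<and> card T = 2" if "\<mu> v T \<noteq> 0" for v T
  proof -
    define i where "i = (SOME i. i \<in> slack v b)"
    have ne: "slack v b \<noteq> {}" and m: "koszul_wedge i (\<delta> v) T \<noteq> 0"
      using that unfolding \<mu>_def i_def by (auto split: if_splits)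
    have i: "i \<in> slack v b" using ne some_in_eq[of "slack v b"] unfolding i_def by blast
    have *: "i \<in> T" "\<delta> v (T - {i}) \<noteq> 0" using m by (auto simp: koszul_wedge_def split: if_splits)
    then obtain j where j: "j \<in> slack v b" "T - {i} = {j}" using delta_supp by blast
    then have T: "T = {i, j}" "i \<noteq> j" using * by auto
    then show ?thesis using i j delta_supp[OF *(2)] by auto
  qed
  have mu_bd: "koszul_bd B (\<lambda>_. 1) (\<mu> v) T = \<delta> v T" for v T
  proof (cases "slack v b = {}")
    case True
    then have "\<delta> v T = 0" using delta_supp by blast
    then show ?thesis using True by (simp add: \<mu>_def)
  next
    case False
    define i where "i = (SOME i. i \<in> slack v b)"
    have "i \<in> B" using False some_in_eq[of "slack v b"] SB[of v] unfolding i_def by blast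
    have "koszul_wedge i (koszul_bd B (\<lambda>_. 1) (\<delta> v)) T = 0"
      by (simp add: koszul_wedge_def delta_cyc)
    then show ?thesis
      using koszul_bd_koszul_wedge[OF finB \<open>i \<in> B\<close>, of "\<lambda>_. 1" "\<delta> v" T] False by (simp add: \<mu>_def i_def)
  qed
  \<comment> \<open>The image over S: its coefficients lie in the ideal, and it is a cycle since
    graph boundaries sum to zero over V.\<close>
  define M where "M T = (\<Sum>v\<in>V. \<mu> v T)" for T
  have M_bd: "koszul_bd B (\<lambda>_. 1) M T = 0" for T
  proof -
    have "koszul_bd B (\<lambda>_. 1) M T = (\<Sum>v\<in>V. koszul_bd B (\<lambda>_. 1) (\<mu> v) T)"
      unfolding M_def by (rule koszul_bd_sum)
    also have "\<dots> = (\<Sum>v\<in>V. graph_bd E (\<lambda>e. \<rho> e T) v)" unfolding mu_bd \<delta>_def ..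
    finally show ?thesis using sum_graph_bd[OF finV E(1)] by simp
  qed
  have M_supp: "covered V b T \<and> T \<subseteq> B \<and> card T = 2" if Mne: "M T \<noteq> 0" for T
  proof -
    obtain v where "v \<in> V" "\<mu> v T \<noteq> 0" 
      using sum.not_neutral_contains_not_neutral[OF Mne[unfolded M_def]] by blast
    then show ?thesis using mu_supp[of v T] SB[of v] unfolding covered_def by blast
  qed
  \<comment> \<open>Over S the complex is contracted by any variable dividing x^b, so M has a
    filling y in degree 3. Modulo the ideal, y is a cycle.\<close>
  have "\<exists>y. koszul_chain B 3 y \<and> (\<forall>T. koszul_bd B (\<lambda>_. 1) y T = M T)"
  proof (cases "B = {}")
    case True
    then have "M T = 0" for T using M_supp[of T] by (cases "M T = 0") auto
    then show ?thesis by (intro exI[of _ "\<lambda>_. 0"]) (simp add: koszul_chain_def)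
  next
    case False
    then obtain j where j: "j \<in> B" by blast
    have "koszul_chain B 2 M" using M_supp by (auto simp: koszul_chain_def)
    then have "koszul_chain B 3 (koszul_wedge j M)"
      using koszul_chain_koszul_wedge[OF _ j finB] by (simp add: eval_nat_numeral)
    moreover have "koszul_wedge j (koszul_bd B (\<lambda>_. 1) M) T = 0" for T
      by (simp add: koszul_wedge_def M_bd)
    ultimately show ?thesis
      using koszul_bd_koszul_wedge[OF finB j, of "\<lambda>_. 1" M] by (intro exI[of _ "koszul_wedge j M"]) simp
  qed
  then obtain y where y: "koszul_chain B 3 y" "\<And>T. koszul_bd B (\<lambda>_. 1) y T = M T" by blast
  have "koszul_bd B (\<lambda>_. 1) y U = 0" if "\<not> covered V b U" for U
    using M_supp[of U] that y(2) by metis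
  \<comment> \<open>Here the vanishing of homology in degree 3 enters. Subtracting the boundary of w
    from y leaves a filling q of M whose coefficients lie in the ideal.\<close>
  then obtain w where w: "koszul_chain B 4 w"
    "\<And>T. T \<subseteq> B \<Longrightarrow> card T = 3 \<Longrightarrow> \<not> covered V b T \<Longrightarrow> y T = koszul_bd B (\<lambda>_. 1) w T"
    using van[OF b] y(1) unfolding koszul_vanishing_def B_def[symmetric] by metis
  define q where "q T = y T - koszul_bd B (\<lambda>_. 1) w T" for T
  have "koszul_chain B 3 (koszul_bd B (\<lambda>_. 1) w)"
    using koszul_chain_koszul_bd[of B 3 w] w(1) finB by (simp add: eval_nat_numeral)
  then have q_supp: "covered V b T \<and> T \<subseteq> B \<and> card T = 3" if "q T \<noteq> 0" for T
    using that y(1) w(2)[of T] unfolding q_def koszul_chain_def by (metis diff_self)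
  have q_bd: "koszul_bd B (\<lambda>_. 1) q T = M T" for T
    unfolding q_def koszul_bd_diff y(2) koszul_bd_koszul_bd[OF finB] by simp
  \<comment> \<open>To lift q from the ideal to S^V, each coefficient is assigned to one generator
    dividing x^b / (product of the variables in T).\<close>
  define \<kappa> where "\<kappa> T = (SOME v. v \<in> V \<and> v \<le> b \<and> T \<subseteq> slack v b)" for T
  have kappa: "\<kappa> T \<in> V \<and> \<kappa> T \<le> b \<and> T \<subseteq> slack (\<kappa> T) b" if "covered V b T" for T
  proof -
    have "\<exists>v. v \<in> V \<and> v \<le> b \<and> T \<subseteq> slack v b"
      using that unfolding covered_def by blast
    from someI_ex[OF this] show ?thesis unfolding \<kappa>_def .
  qed
  define s where "s v T = (if v = \<kappa> T then q T else 0)" for v T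
  have s_supp: "v \<in> V \<and> v \<le> b \<and> T \<subseteq> slack v b \<and> card T = 3" if "s v T \<noteq> 0" for v T
    using that q_supp[of T] kappa[of T] unfolding s_def by (metis)
  have s_sum: "(\<Sum>v\<in>V. s v T) = q T" for T
  proof (cases "q T = 0")
    case True
    then show ?thesis by (simp add: s_def cong: if_cong)
  next
    case False
    then have "\<kappa> T \<in> V" using q_supp kappa by blast
    then show ?thesis using finV by (simp add: s_def)
  qed
  \<comment> \<open>Subtracting the boundary of the lift makes the sums over V vanish and leaves the
    Koszul boundary unchanged, so \<open>graph_bd_fill\<close> applies to each coefficient.\<close>
  define f where "f v T = \<mu> v T - koszul_bd B (\<lambda>_. 1) (s v) T" for v T
  have f_supp: "v \<in> V \<and> v \<le> b \<and> T \<subseteq> slack v b \<and> card T = 2" if "f v T \<noteq> 0" for v T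
  proof (cases "\<mu> v T = 0")
    case True
    then have "koszul_bd B (\<lambda>_. 1) (s v) T \<noteq> 0" using that by (simp add: f_def)
    then obtain j where j: "j \<notin> T" "s v (insert j T) \<noteq> 0"
      using koszul_bd_eq_0[of B T "s v" "\<lambda>_. 1"] by blast
    have *: "insert j T \<subseteq> slack v b" "card (insert j T) = 3" "v \<in> V" "v \<le> b" using s_supp[OF j(2)] by auto
    then have "finite T" using finB SB[of v] by (meson finite_insert finite_subset)
    then show ?thesis using * j by auto
  qed (use mu_supp in blast)
  have f_sum: "(\<Sum>v\<in>V. f v T) = 0" for T
  proof -
    have "(\<Sum>v\<in>V. koszul_bd B (\<lambda>_. 1) (s v) T) = koszul_bd B (\<lambda>_. 1) q T"
      unfolding koszul_bd_sum[symmetric] s_sum ..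
    then show ?thesis unfolding f_def sum_subtractf q_bd M_def by simp
  qed
  have f_bd: "koszul_bd B (\<lambda>_. 1) (f v) T = \<delta> v T" for v T
    unfolding f_def koszul_bd_diff mu_bd koszul_bd_koszul_bd[OF finB] by simp
  \<comment> \<open>The multidegree of the coefficient of e_T inside total degree b.\<close>
  define c where "c T i = (if i \<in> T then b i - 1 else b i)" for T i
  have le_c: "v \<le> b \<and> T \<subseteq> slack v b \<longleftrightarrow> v \<le> c T" if "T \<subseteq> B" for v T
    using that unfolding le_fun_def c_def slack_def B_def by (fastforce split: if_splits)
  have "\<exists>t. (\<forall>e. t e \<noteq> 0 \<longrightarrow> e \<in> E \<and> fst e \<le> b \<and> snd e \<le> b \<and> T \<subseteq> S e) \<and> (\<forall>v. graph_bd E t v = f v T)" for T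
  proof (cases "T \<subseteq> B")
    case True
    have "\<exists>t. (\<forall>e. t e \<noteq> 0 \<longrightarrow> e \<in> E \<and> fst e \<le> c T \<and> snd e \<le> c T) \<and> (\<forall>v. graph_bd E t v = f v T)"
      by (rule graph_bd_fill[OF finV finE E(2) _ f_sum]) (use f_supp le_c[OF True] in blast)
    then show ?thesis using le_c[OF True] unfolding S_def by (metis Int_subset_iff)
  next
    case False
    then have "f v T = 0" for v using f_supp SB by blast
    then show ?thesis by (intro exI[of _ "\<lambda>_. 0"]) (simp add: graph_bd_def)
  qed
  then obtain t' where t': "\<And>T e. t' T e \<noteq> 0 \<Longrightarrow> e \<in> E \<and> fst e \<le> b \<and> snd e \<le> b \<and> T \<subseteq> S e"
    "\<And>T v. graph_bd E (t' T) v = f v T" by metis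
  define t where "t e T = t' T e" for e T
  have t: "graph_bd E (\<lambda>e. t e T) v = f v T" for T v
    using t'(2) by (simp add: t_def)
  \<comment> \<open>Its entry at a singleton {i} is a graph cycle of multidegree b lowered by one in
    i, so the induction hypothesis applies to it.\<close>
  define g where "g e T = \<rho> e T - koszul_bd B (\<lambda>_. 1) (t e) T" for e T
  have g_cyc: "graph_bd E (\<lambda>e. g e T) v = 0" for T v
    unfolding g_def graph_bd_diff graph_bd_koszul_bd_commute t f_bd \<delta>_def by simp
  have g0: "g e {i} = 0" if i: "i \<in> B" for i e
  proof -
    have iN: "i \<in> N" using i b B_def by blast
    show ?thesis
    proof (rule less.hyps[of "c {i}" "\<lambda>e. g e {i}"])
      show "(\<Sum>j\<in>N. c {i} j) < (\<Sum>j\<in>N. b j)"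
        using N iN i by (intro sum_strict_mono_ex1) (auto simp: c_def B_def)
      have "{j. 0 < c {i} j} \<subseteq> {j. 0 < b j}" by (auto simp: c_def split: if_splits)
      then show "{j. 0 < c {i} j} \<subseteq> N" using b by (rule subset_trans)
      fix e assume "g e {i} \<noteq> 0"
      then have "e \<in> E \<and> fst e \<le> b \<and> snd e \<le> b \<and> i \<in> S e"
      proof (cases "\<rho> e {i} = 0")
        case True
        then have "koszul_bd B (\<lambda>_. 1) (t e) {i} \<noteq> 0" using \<open>g e {i} \<noteq> 0\<close> by (simp add: g_def)
        then obtain j where "t e (insert j {i}) \<noteq> 0"
          using koszul_bd_eq_0[of B "{i}" "t e" "\<lambda>_. 1"] by blast
        then show ?thesis using t'(1)[of "insert j {i}" e] unfolding t_def by blast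
      next
        case False
        then have "r e \<noteq> 0" "i = \<iota> e" by (auto simp: \<rho>_def split: if_splits)
        then show ?thesis using supp[of e] iota[of e] by blast
      qed
      then show "e \<in> E \<and> fst e \<le> c {i} \<and> snd e \<le> c {i}"
        using le_c[of "{i}"] i unfolding S_def by blast
    qed (rule g_cyc)
  qed
  \<comment> \<open>Since g vanishes on singletons, \<open>\<rho> e\<close> agrees there with a
    boundary, and r is the boundary of a boundary.\<close>
  have "r e = koszul_bd B (\<lambda>_. 1) (\<rho> e) {}" by (simp add: rho_bd)
  also have "\<dots> = koszul_bd B (\<lambda>_. 1) (koszul_bd B (\<lambda>_. 1) (t e)) {}"
    unfolding koszul_bd_def[of B _ _ "{}"]
    by (rule sum.cong) (use g0[of _ e] in \<open>simp_all add: g_def\<close>)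
  also have "\<dots> = 0" by (rule koszul_bd_koszul_bd[OF finB])
  finally show ?case .
qed

text \<open>For each generator in the list, the colon by it of the ideal generated by its predecessors
  is the principal ideal generated by \<open>lcm(xs ! k, p) / (xs ! k)\<close>.\<close>

definition principal_colons :: "(nat \<Rightarrow> nat) list \<Rightarrow> bool" where
  "principal_colons xs \<longleftrightarrow> (\<forall>k. 0 < k \<longrightarrow> k < length xs \<longrightarrow>
     (\<exists>p\<in>set (take k xs). \<forall>l\<in>set (take k xs). p \<le> sup (xs ! k) l))"

text \<open>The list may repeat generators and contain redundant ones: lowering exponents can merge
  generators or make one divide another, and the property has to survive this.\<close>

definition principal_tree :: "(nat \<Rightarrow> nat) set \<Rightarrow> bool" where
  "principal_tree V \<longleftrightarrow> (\<exists>xs. xs \<noteq> [] \<and> set xs = V \<and> principal_colons xs)"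

lemma principal_colons_snoc:
  "principal_colons (ys @ [u]) \<longleftrightarrow>
     principal_colons ys \<and> (ys = [] \<or> (\<exists>p\<in>set ys. \<forall>l\<in>set ys. p \<le> sup u l))"
proof
  assume xs: "principal_colons (ys @ [u])"
  have "\<exists>p\<in>set (take k ys). \<forall>l\<in>set (take k ys). p \<le> sup (ys ! k) l" if "0 < k" "k < length ys" for k
    using xs[unfolded principal_colons_def, rule_format, of k] that by (simp add: nth_append)
  moreover have "\<exists>p\<in>set ys. \<forall>l\<in>set ys. p \<le> sup u l" if "ys \<noteq> []"
    using xs[unfolded principal_colons_def, rule_format, of "length ys"] that by simp
  ultimately show "principal_colons ys \<and> (ys = [] \<or> (\<exists>p\<in>set ys. \<forall>l\<in>set ys. p \<le> sup u l))"
    unfolding principal_colons_def by blast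
next
  assume ys: "principal_colons ys \<and> (ys = [] \<or> (\<exists>p\<in>set ys. \<forall>l\<in>set ys. p \<le> sup u l))"
  show "principal_colons (ys @ [u])"
    unfolding principal_colons_def
  proof (intro allI impI)
    fix k assume k: "0 < k" "k < length (ys @ [u])"
    show "\<exists>p\<in>set (take k (ys @ [u])). \<forall>l\<in>set (take k (ys @ [u])). p \<le> sup ((ys @ [u]) ! k) l"
    proof (cases "k < length ys")
      case True
      then show ?thesis
        using ys[THEN conjunct1, unfolded principal_colons_def, rule_format, of k] k(1)
        by (simp add: nth_append)
    next
      case False
      then have "k = length ys" using k(2) by simp
      then show ?thesis using ys k(1) by auto
    qed
  qed
qed

lemma principal_tree_single: "principal_tree {v}"
  unfolding principal_tree_def by (rule exI[of _ "[v]"]) (simp add: principal_colons_def)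

lemma principal_tree_leaf:
  assumes "principal_tree V" "p \<in> V" "\<And>l. l \<in> V \<Longrightarrow> p \<le> sup u l"
  shows "principal_tree (insert u V)"
proof -
  obtain xs where xs: "set xs = V" "principal_colons xs"
    using assms(1) unfolding principal_tree_def by blast
  then have "principal_colons (xs @ [u])"
    unfolding principal_colons_snoc using assms(2,3) by blast
  then show ?thesis
    unfolding principal_tree_def using xs(1) by (intro exI[of _ "xs @ [u]"]) simp
qed

lemma principal_tree_finite: "principal_tree V \<Longrightarrow> finite V"
  unfolding principal_tree_def by (elim exE conjE) (use finite_set in blast)

text \<open>In a list of minimal length the last generator does not occur among the others.\<close>

lemma principal_tree_cases [consumes 1, case_names single leaf]:
  assumes "principal_tree V"
  obtains (single) v where "V = {v}"
  | (leaf) W u p where "V = insert u W" "principal_tree W" "u \<notin> W" "p \<in> W" "\<And>l. l \<in> W \<Longrightarrow> p \<le> sup u l"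
proof -
  let ?P = "\<lambda>xs. xs \<noteq> [] \<and> set xs = V \<and> principal_colons xs"
  obtain zs where "?P zs" using assms unfolding principal_tree_def by (rule exE)
  from ex_has_least_nat[where P = ?P, OF this, of length]
  obtain xs where "?P xs \<and> (\<forall>ys. ?P ys \<longrightarrow> length xs \<le> length ys)" by (rule exE)
  then have xs: "xs \<noteq> []" "set xs = V" "principal_colons xs"
    and least: "\<And>ys. ?P ys \<Longrightarrow> length xs \<le> length ys" by simp_all
  obtain ys u where ys: "xs = ys @ [u]" using xs(1) by (metis append_butlast_last_id)
  show thesis
  proof (cases "ys = []")
    case True
    then show thesis using xs(2) ys by (intro single[of u]) simp
  next
    case False
    then obtain p where p: "p \<in> set ys" "\<And>l. l \<in> set ys \<Longrightarrow> p \<le> sup u l" and "principal_colons ys"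
      using xs(3) unfolding ys principal_colons_snoc by blast
    then have "principal_tree (set ys)"
      unfolding principal_tree_def using False by blast
    moreover have "u \<notin> set ys"
    proof
      assume "u \<in> set ys"
      then have "?P ys" using False \<open>principal_colons ys\<close> xs(2) ys by auto
      from least[OF this] show False using ys by simp
    qed
    moreover have "V = insert u (set ys)" using xs(2) ys by simp
    ultimately show thesis using p by (intro leaf[of u "set ys" p])
  qed
qed

text \<open>Truncated subtraction of w is monotone and commutes with the maximum, so the list is
  mapped entry by entry and p - w serves as the new witness.\<close>

lemma principal_tree_diff_image:
  assumes "principal_tree V"
  shows "principal_tree ((\<lambda>v. v - w) ` V)"
proof -
  obtain xs where xs: "xs \<noteq> []" "set xs = V" "principal_colons xs"
    using assms unfolding principal_tree_def by blast
  have mono: "p - w \<le> sup (u - w) (l - w)" if "p \<le> sup u l" for p u l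
  proof (rule le_funI)
    fix i
    have "p i \<le> max (u i) (l i)" using that by (simp add: le_fun_def sup_max)
    then have "p i - w i \<le> max (u i - w i) (l i - w i)" by linarith
    then show "(p - w) i \<le> sup (u - w) (l - w) i" by (simp add: sup_max)
  qed
  have "principal_colons (map (\<lambda>v. v - w) xs)"
    unfolding principal_colons_def
  proof (intro allI impI)
    fix k assume k: "0 < k" "k < length (map (\<lambda>v. v - w) xs)"
    then obtain p where p: "p \<in> set (take k xs)" "\<And>l. l \<in> set (take k xs) \<Longrightarrow> p \<le> sup (xs ! k) l"
      using xs(3)[unfolded principal_colons_def, rule_format, of k] by auto
    show "\<exists>p\<in>set (take k (map (\<lambda>v. v - w) xs)).
        \<forall>l\<in>set (take k (map (\<lambda>v. v - w) xs)). p \<le> sup (map (\<lambda>v. v - w) xs ! k) l"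
      unfolding take_map set_map using p(1) k(2)
      by (intro bexI[of _ "p - w"] ballI) (auto intro!: mono p(2))
  qed
  then show ?thesis
    unfolding principal_tree_def using xs(1,2) by (intro exI[of _ "map (\<lambda>v. v - w) xs"]) simp
qed

text \<open>Acyclicity, stated edge by edge. Loops and pairs of opposite edges are excluded too,
  since the closure is reflexive and symmetric.\<close>

definition bridges :: "('v \<times> 'v) set \<Rightarrow> bool" where
  "bridges E \<longleftrightarrow> (\<forall>e\<in>E. e \<notin> ((E - {e}) \<union> (E - {e})\<inverse>)\<^sup>*)"

lemma sym_rtrancl_Un_converse: "(x, y) \<in> (E \<union> E\<inverse>)\<^sup>* \<Longrightarrow> (y, x) \<in> (E \<union> E\<inverse>)\<^sup>*"
  using sym_rtrancl[OF sym_Un_converse] by (rule symD)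

text \<open>A vertex at maximal distance from a base point does not separate the graph,
  so a second edge at it would not be a bridge.\<close>

lemma leaf_exists:
  assumes "finite V" "2 \<le> card V" "E \<subseteq> V \<times> V" "bridges E"
    and conn: "\<And>u v. u \<in> V \<Longrightarrow> v \<in> V \<Longrightarrow> (u, v) \<in> (E \<union> E\<inverse>)\<^sup>*"
  shows "\<exists>u\<in>V. \<exists>p\<in>V. p \<noteq> u \<and> (\<forall>q. (u, q) \<in> E \<union> E\<inverse> \<longrightarrow> q = p)"
proof -
  let ?G = "E \<union> E\<inverse>"
  have "V \<noteq> {}" using assms(2) by auto
  then obtain r where r: "r \<in> V" by blast
  define d where "d x = (LEAST k. (r, x) \<in> ?G ^^ k)" for x
  have pred: "\<exists>y. (y, x) \<in> ?G \<and> d y < d x" if x: "x \<in> V" "x \<noteq> r" for x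
  proof -
    have "\<exists>k. (r, x) \<in> ?G ^^ k"
      using conn[OF r x(1)] rtrancl_power by blast
    then have k: "(r, x) \<in> ?G ^^ d x" unfolding d_def by (rule LeastI_ex)
    then obtain j where j: "d x = Suc j" using x(2) by (cases "d x") auto
    then obtain y where y: "(r, y) \<in> ?G ^^ j" "(y, x) \<in> ?G" using k by auto
    have "d y \<le> j" unfolding d_def by (rule Least_le) (rule y(1))
    then show ?thesis using y(2) j by auto
  qed
  have "Max (d ` V) \<in> d ` V" using assms(1) \<open>V \<noteq> {}\<close> by (intro Max_in) auto
  then obtain u where u: "u \<in> V" "d u = Max (d ` V)" by auto
  have max: "d x \<le> d u" if "x \<in> V" for x using that u(2) assms(1) by simp
  define A where "A = {(a, b) \<in> ?G. a \<noteq> u \<and> b \<noteq> u}"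
  have GV: "x \<in> V \<and> y \<in> V" if "(x, y) \<in> ?G" for x y using that assms(3) by auto
  have "u \<noteq> r"
  proof
    assume "u = r"
    obtain x where x: "x \<in> V" "x \<noteq> r"
    proof -
      have "\<not> V \<subseteq> {r}" using assms(2) card_mono[of "{r}" V] by auto
      then show thesis using that by blast
    qed
    then obtain y where "(y, x) \<in> ?G" "d y < d x" using pred by blast
    moreover have "d r = 0" unfolding d_def by (rule Least_eq_0) simp
    ultimately show False using max[OF x(1)] \<open>u = r\<close> by simp
  qed
  \<comment> \<open>Stepping from x to a neighbour closer to r never meets u, because no distance
    exceeds that of u.\<close>
  have avoid: "(r, x) \<in> A\<^sup>*" if "x \<in> V" "x \<noteq> u" for x
    using that
  proof (induction "d x" arbitrary: x rule: less_induct)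
    case less
    show ?case
    proof (cases "x = r")
      case False
      then obtain y where y: "(y, x) \<in> ?G" "d y < d x" using pred less.prems by blast
      have "y \<noteq> u" using y(2) max[OF less.prems(1)] by auto
      moreover have "y \<in> V" using GV y(1) by blast
      ultimately have "(r, y) \<in> A\<^sup>*" using less.hyps y(2) by blast
      moreover have "(y, x) \<in> A" using y(1) \<open>y \<noteq> u\<close> less.prems by (auto simp: A_def)
      ultimately show ?thesis by (rule rtrancl_into_rtrancl)
    qed simp
  qed
  obtain p where p: "(p, u) \<in> ?G" "d p < d u" using pred u(1) \<open>u \<noteq> r\<close> by blast
  have pV: "p \<in> V" "p \<noteq> u" using p GV by auto
  have "q = p" if q: "(u, q) \<in> ?G" for q
  proof (rule ccontr)
    assume "q \<noteq> p"
    obtain e where e: "e \<in> E" "e = (u, q) \<or> e = (q, u)" using q by auto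
    let ?H = "(E - {e}) \<union> (E - {e})\<inverse>"
    have "(u, u) \<notin> E" using assms(4) unfolding bridges_def by auto
    then have "q \<noteq> u" using q by auto
    have "A \<subseteq> ?H" using e(2) unfolding A_def by auto
    then have AH: "A\<^sup>* \<subseteq> ?H\<^sup>*" by (rule rtrancl_mono)
    have "(u, p) \<in> ?H" using p(1) e(2) \<open>q \<noteq> p\<close> pV(2) by auto
    moreover have "(r, p) \<in> ?H\<^sup>*" using avoid[OF pV] AH by blast
    then have "(p, r) \<in> ?H\<^sup>*" by (rule sym_rtrancl_Un_converse)
    moreover have "(r, q) \<in> ?H\<^sup>*" using avoid[of q] AH \<open>q \<noteq> u\<close> q GV by blast
    ultimately have "(u, q) \<in> ?H\<^sup>*" by (meson converse_rtrancl_into_rtrancl rtrancl_trans)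
    moreover from this have "(q, u) \<in> ?H\<^sup>*" by (rule sym_rtrancl_Un_converse)
    ultimately show False using e assms(4) unfolding bridges_def by blast
  qed
  then show ?thesis using u(1) pV by blast
qed

lemma inside_subset: "inside E c \<subseteq> E \<union> E\<inverse>"
  by (auto simp: inside_def)

lemma linked_bridges_principal_tree:
  fixes V :: "(nat \<Rightarrow> nat) set"
  assumes "finite V" "V \<noteq> {}" "E \<subseteq> V \<times> V" "linked V E" "bridges E"
  shows "principal_tree V"
  using assms
proof (induction "card V" arbitrary: V E rule: less_induct)
  case less
  show ?case
  proof (cases "2 \<le> card V")
    case False
    then have "card V = 1" using less.prems(1,2) card_gt_0_iff[of V] by linarith
    then obtain v where "V = {v}" by (auto simp: card_1_singleton_iff)
    then show ?thesis by (simp add: principal_tree_single)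
  next
    case True
    have conn: "(u, v) \<in> (E \<union> E\<inverse>)\<^sup>*" if "u \<in> V" "v \<in> V" for u v
    proof -
      have "(u, v) \<in> (inside E (sup u v))\<^sup>*" using less.prems(4) that by (simp add: linked_def)
      then show ?thesis using rtrancl_mono[OF inside_subset] by blast
    qed
    obtain u p where u: "u \<in> V" and p: "p \<in> V" "p \<noteq> u" and leaf: "\<And>q. (u, q) \<in> E \<union> E\<inverse> \<Longrightarrow> q = p"
      using leaf_exists[OF less.prems(1) True less.prems(3,5) conn] by blast
    define W F where "W = V - {u}" and "F = {e \<in> E. fst e \<noteq> u \<and> snd e \<noteq> u}"
    \<comment> \<open>The path from u to l inside lcm(u, l) has to leave u along its only edge, so p
      lies below this lcm.\<close>
    have leaf_le: "p \<le> sup u l" if "l \<in> W" for l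
    proof -
      have "(u, l) \<in> (inside E (sup u l))\<^sup>*" "u \<noteq> l"
        using less.prems(4) that u by (auto simp: linked_def W_def)
      then obtain q where "(u, q) \<in> inside E (sup u l)" by (meson converse_rtranclE)
      then show ?thesis using leaf[of q] by (auto simp: inside_def)
    qed
    have "linked W F"
      unfolding linked_def
    proof (intro ballI)
      fix x y assume xy: "x \<in> W" "y \<in> W"
      let ?c = "sup x y"
      \<comment> \<open>Contracting the leaf edge onto p turns paths of E into paths of F: an edge
        at u becomes a trivial step and all other edges are kept, so the bound \<open>?c\<close> is
        respected.\<close>
      define \<pi> where "\<pi> v = (if v = u then p else v)" for v
      have edge: "(\<pi> a, \<pi> b) \<in> (inside F ?c)\<^sup>*" if ab: "(a, b) \<in> inside E ?c" for a b
      proof (cases "a = u \<or> b = u")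
        case True
        have "(a, b) \<in> E \<union> E\<inverse>" "(b, a) \<in> E \<union> E\<inverse>" using ab by (auto simp: inside_def)
        then have "\<pi> a = \<pi> b" using True leaf unfolding \<pi>_def by metis
        then show ?thesis by simp
      next
        case False
        then have "(a, b) \<in> inside F ?c" using ab by (auto simp: inside_def F_def)
        then show ?thesis using False by (simp add: \<pi>_def r_into_rtrancl)
      qed
      define c where "c = ?c"
      have "(x, y) \<in> (inside E c)\<^sup>*" using less.prems(4) xy by (auto simp: linked_def W_def c_def)
      then have "(\<pi> x, \<pi> y) \<in> (inside F c)\<^sup>*"
      proof (induction rule: rtrancl_induct)
        case (step y z)
        show ?case
          by (rule rtrancl_trans[OF step.IH edge[OF step.hyps(2)[unfolded c_def], folded c_def]])
      qed simp
      then show "(x, y) \<in> (inside F ?c)\<^sup>*" using xy by (auto simp: \<pi>_def W_def c_def)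
    qed
    moreover have "bridges F"
      unfolding bridges_def
    proof (intro ballI notI)
      fix e assume e: "e \<in> F" "e \<in> ((F - {e}) \<union> (F - {e})\<inverse>)\<^sup>*"
      have "((F - {e}) \<union> (F - {e})\<inverse>)\<^sup>* \<subseteq> ((E - {e}) \<union> (E - {e})\<inverse>)\<^sup>*"
        by (rule rtrancl_mono) (auto simp: F_def)
      then show False using e less.prems(5) unfolding bridges_def F_def by blast
    qed
    moreover have "F \<subseteq> W \<times> W" using less.prems(3) by (auto simp: F_def W_def)
    moreover have "card W < card V" "finite W" "W \<noteq> {}"
      using u p less.prems(1) card_Diff1_less[of V u] by (auto simp: W_def)
    ultimately have "principal_tree W" using less.hyps by blast
    then have "principal_tree (insert u W)"
      by (rule principal_tree_leaf[where p = p]) (use p leaf_le in \<open>auto simp: W_def\<close>)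
    moreover have "insert u W = V" using u by (auto simp: W_def)
    ultimately show ?thesis by simp
  qed
qed

text \<open>An edge that is not a bridge closes up to a cycle in which its own coefficient is -1,
  but all cycles vanish.\<close>

lemma koszul_vanishing_principal_tree:
  assumes finV: "finite V" "V \<noteq> {}" and N: "finite N" "\<And>v. v \<in> V \<Longrightarrow> {i. 0 < v i} \<subseteq> N"
    and van: "\<And>b. {i. 0 < b i} \<subseteq> N \<Longrightarrow> koszul_vanishing TYPE('r::comm_ring_1) V b"
  shows "principal_tree V"
proof -
  obtain E where E: "E \<subseteq> V \<times> V" "linked V E" and min: "\<And>e. e \<in> E \<Longrightarrow> \<not> linked V (E - {e})"
    using minimal_linked[OF finV(1)] by blast
  have finE: "finite E" using E(1) finV(1) finite_subset by blast
  \<comment> \<open>A common multiple of all generators, so that the bound cuts off no edge; as a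
    sum it keeps its support inside N.\<close>
  define b where "b i = (\<Sum>v\<in>V. v i)" for i
  have le_b: "v \<le> b" if "v \<in> V" for v
    using that finV(1) by (auto simp: le_fun_def b_def intro: member_le_sum)
  have supp_b: "{i. 0 < b i} \<subseteq> N"
  proof
    fix i assume "i \<in> {i. 0 < b i}"
    then have "(\<Sum>v\<in>V. v i) \<noteq> 0" by (simp add: b_def)
    then obtain v where "v \<in> V" "v i \<noteq> 0" by (rule sum.not_neutral_contains_not_neutral)
    then show "i \<in> N" using N(2) by auto
  qed
  have "bridges E"
    unfolding bridges_def
  proof (intro ballI notI)
    fix e assume e: "e \<in> E" "e \<in> ((E - {e}) \<union> (E - {e})\<inverse>)\<^sup>*"
    obtain u v where uv: "e = (u, v)" by force
    have "(E - {e}) \<union> (E - {e})\<inverse> \<subseteq> inside (E - {e}) b"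
      using E(1) le_b by (auto simp: inside_def)
    then have "(u, v) \<in> (inside (E - {e}) b)\<^sup>*" using e(2) uv rtrancl_mono by blast
    then obtain f :: "_ \<Rightarrow> 'r" where f: "\<And>a. f a \<noteq> 0 \<Longrightarrow> a \<in> E - {e} \<and> fst a \<le> b \<and> snd a \<le> b"
      "\<And>w. graph_bd (E - {e}) f w = of_bool (v = w) - of_bool (u = w)"
      using path_chain[of u v "E - {e}" b] finE by blast
    have fe: "f e = 0" using f(1)[of e] by blast
    have same: "graph_bd E f w = graph_bd (E - {e}) f w" for w
      unfolding graph_bd_def using finE e(1) fe by (simp add: sum.remove)
    have cyc: "graph_bd E (\<lambda>a. f a - of_bool (a = e)) w = 0" for w
    proof -
      have "graph_bd E (\<lambda>a. of_bool (a = e)) w = (of_bool (v = w) - of_bool (u = w) :: 'r)"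
        using graph_bd_single[OF finE e(1), of w] unfolding uv by simp
      then show ?thesis
        unfolding graph_bd_diff same f(2) by simp
    qed
    have supp: "a \<in> E \<and> fst a \<le> b \<and> snd a \<le> b" if "f a - of_bool (a = e) \<noteq> 0" for a
    proof (cases "f a = 0")
      case True
      then have "a = e" using that by (cases "a = e") auto
      then show ?thesis using e(1) E(1) le_b by auto
    qed (use f(1)[of a] in blast)
    have "f e - of_bool (e = e) = 0"
      by (rule cycle_vanishes_below[OF finV(1) E min van N(1) supp_b supp cyc])
    then show False using fe by simp
  qed
  then show ?thesis using linked_bridges_principal_tree[OF finV E] by blast
qed

section \<open>Monomial ideals\<close>

abbreviation "lkp \<equiv> Poly_Mapping.lookup"
abbreviation "keys \<equiv> Poly_Mapping.keys"

text \<open>Membership is read off from the occurring monomials, with exponents as plain functions: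
  divisibility is the pointwise order and the lcm is \<open>sup\<close>, so the graph lemmas apply
  directly to V.\<close>

definition mono_ideal :: "nat \<Rightarrow> (nat \<Rightarrow> nat) set \<Rightarrow> ('a::field) mpoly set" where
  "mono_ideal n V = {p \<in> Spoly n. \<forall>m\<in>keys p. \<exists>v\<in>V. v \<le> lkp m}"

definition unit_vec :: "nat \<Rightarrow> nat \<Rightarrow> nat" where
  "unit_vec i j = of_bool (i = j)"

definition var :: "nat \<Rightarrow> ('a::field) mpoly" where
  "var i = monom (Poly_Mapping.single i 1)"

lemma lookup_single_unit: "lkp (Poly_Mapping.single i 1) = unit_vec i"
  by (rule ext) (simp add: lookup_single unit_vec_def when_def)

lemma keys_plus_nat: "keys (m + k :: nat \<Rightarrow>\<^sub>0 nat) = keys m \<union> keys k"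
  by (auto simp: in_keys_iff lookup_add)

lemma Spoly_0 [simp]: "0 \<in> Spoly n"
  by (simp add: Spoly_def)

lemma Spoly_1 [simp]: "1 \<in> Spoly n"
  by (simp add: Spoly_def)

lemma Spoly_add: "p \<in> Spoly n \<Longrightarrow> q \<in> Spoly n \<Longrightarrow> p + q \<in> Spoly n"
  using keys_add[of p q] by (auto simp: Spoly_def)

lemma keys_uminus: "keys (- p :: 'b \<Rightarrow>\<^sub>0 'a::ab_group_add) = keys p"
  by (auto simp: in_keys_iff)

lemma Spoly_uminus: "p \<in> Spoly n \<Longrightarrow> - p \<in> Spoly n"
  by (simp add: Spoly_def keys_uminus)

lemma Spoly_diff: "p \<in> Spoly n \<Longrightarrow> q \<in> Spoly n \<Longrightarrow> p - q \<in> Spoly n"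
  using Spoly_add[of p n "- q"] Spoly_uminus[of q n] by simp

lemma Spoly_mult:
  assumes "p \<in> Spoly n" "q \<in> Spoly n"
  shows "p * q \<in> Spoly n"
  unfolding Spoly_def
proof (intro CollectI ballI)
  fix m assume "m \<in> keys (p * q)"
  then obtain a b where "m = a + b" "a \<in> keys p" "b \<in> keys q"
    using keys_mult[of p q] by blast
  then show "keys m \<subseteq> {..<n}"
    using assms by (simp add: keys_plus_nat Spoly_def)
qed

lemma Spoly_sum: "(\<And>s. s \<in> S \<Longrightarrow> f s \<in> Spoly n) \<Longrightarrow> sum f S \<in> Spoly n"
  by (induction S rule: infinite_finite_induct) (auto intro: Spoly_add)

lemma Spoly_single: "keys m \<subseteq> {..<n} \<Longrightarrow> Poly_Mapping.single m c \<in> Spoly n"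
  by (auto simp: Spoly_def)

lemma Spoly_monom: "keys m \<subseteq> {..<n} \<Longrightarrow> monom m \<in> Spoly n"
  unfolding monom_def by (rule Spoly_single)

lemma Spoly_var: "i < n \<Longrightarrow> var i \<in> Spoly n"
  unfolding var_def by (rule Spoly_monom) simp

lemma keys_monom [simp]: "keys (monom m) = {m}"
  by (simp add: monom_def)

lemma monom_inject: "monom m = monom k \<longleftrightarrow> m = k"
  by (metis keys_monom singleton_inject)

lemma monom_eq_1: "monom m = 1 \<longleftrightarrow> m = 0"
  by (metis keys_monom keys_one monom_def single_one singleton_inject)

lemma supp_monom: "supp (monom m) = keys m"
  unfolding supp_def monom_inject by simp

lemma monom_mult: "monom m * monom k = monom (m + k)"
  by (simp add: monom_def mult_single)

lemma lookup_times_monom: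
  fixes p :: "'a::field mpoly"
  shows "lkp (p * monom u) (m + u) = lkp p m"
proof -
  have inner: "(\<Sum>q. lkp (monom u :: 'a mpoly) q when m + u = l + q) = (1 when m = l)" for l
  proof -
    have eq: "(\<lambda>q. lkp (monom u :: 'a mpoly) q when m + u = l + q) = (\<lambda>q. (1 when m = l) when q = u)"
      by (rule ext) (auto simp: monom_def lookup_single when_def)
    show ?thesis unfolding eq by simp
  qed
  show ?thesis
    unfolding lookup_mult inner by (simp add: mult_when)
qed

lemma keys_times_monom: "keys (p * monom u) = (\<lambda>m. m + u) ` keys p"
proof
  show "keys (p * monom u) \<subseteq> (\<lambda>m. m + u) ` keys p"
    using keys_mult[of p "monom u"] by auto
  show "(\<lambda>m. m + u) ` keys p \<subseteq> keys (p * monom u)"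
    by (auto simp: in_keys_iff lookup_times_monom)
qed

lemma poly_mapping_decompose: "p = (\<Sum>m\<in>keys p. Poly_Mapping.single m (lkp p m))"
proof (rule poly_mapping_eqI)
  fix k
  have "lkp (\<Sum>m\<in>keys p. Poly_Mapping.single m (lkp p m)) k
    = (\<Sum>m\<in>keys p. if m = k then lkp p k else 0)"
    unfolding lookup_sum by (rule sum.cong) (auto simp: lookup_single when_def)
  also have "\<dots> = lkp p k" by (auto simp: in_keys_iff)
  finally show "lkp p k = lkp (\<Sum>m\<in>keys p. Poly_Mapping.single m (lkp p m)) k" by simp
qed

section \<open>Ideals and their monomials\<close>

lemma ideal_subset: "is_ideal n J \<Longrightarrow> J \<subseteq> Spoly n"
  by (simp add: is_ideal_def)

lemma ideal_0: "is_ideal n J \<Longrightarrow> 0 \<in> J"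
  by (simp add: is_ideal_def)

lemma ideal_add: "is_ideal n J \<Longrightarrow> p \<in> J \<Longrightarrow> q \<in> J \<Longrightarrow> p + q \<in> J"
  by (simp add: is_ideal_def)

lemma ideal_mult: "is_ideal n J \<Longrightarrow> p \<in> J \<Longrightarrow> g \<in> Spoly n \<Longrightarrow> g * p \<in> J"
  by (simp add: is_ideal_def)

lemma ideal_mult_right: "is_ideal n J \<Longrightarrow> p \<in> J \<Longrightarrow> g \<in> Spoly n \<Longrightarrow> p * g \<in> J"
  using ideal_mult[of n J p g] by (simp add: mult.commute)

lemma ideal_uminus: "is_ideal n J \<Longrightarrow> p \<in> J \<Longrightarrow> - p \<in> J"
  using ideal_mult[of n J p "- 1"] Spoly_uminus[OF Spoly_1, of n] by auto

lemma ideal_diff: "is_ideal n J \<Longrightarrow> p \<in> J \<Longrightarrow> q \<in> J \<Longrightarrow> p - q \<in> J"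
  using ideal_add[of n J p "- q"] ideal_uminus[of n J q] by simp

lemma ideal_sum: "is_ideal n J \<Longrightarrow> (\<And>s. s \<in> S \<Longrightarrow> f s \<in> J) \<Longrightarrow> sum f S \<in> J"
  by (induction S rule: infinite_finite_induct) (auto intro: ideal_add ideal_0)

lemma is_ideal_Spoly: "is_ideal n (Spoly n)"
  by (auto simp: is_ideal_def intro: Spoly_add Spoly_mult)

lemma is_ideal_gen:
  assumes "G \<subseteq> Spoly n"
  shows "is_ideal n (ideal_gen n G)"
proof -
  have "ideal_gen n G \<subseteq> Spoly n"
    unfolding ideal_gen_def using assms is_ideal_Spoly by blast
  then show ?thesis
    unfolding is_ideal_def ideal_gen_def by blast
qed

lemma subset_ideal_gen: "G \<subseteq> ideal_gen n G"
  unfolding ideal_gen_def by blast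

lemma ideal_gen_minimal: "is_ideal n J \<Longrightarrow> G \<subseteq> J \<Longrightarrow> ideal_gen n G \<subseteq> J"
  unfolding ideal_gen_def by blast

lemma ideal_gen_ideal: "is_ideal n J \<Longrightarrow> ideal_gen n J = J"
  by (simp add: ideal_gen_minimal subset_ideal_gen subset_antisym)

lemma ideal_memI_monomials:
  assumes "is_ideal n J" "p \<in> Spoly n" "\<And>m. m \<in> keys p \<Longrightarrow> monom m \<in> J"
  shows "p \<in> J"
proof -
  have "Poly_Mapping.single m (lkp p m) \<in> J" if "m \<in> keys p" for m
  proof -
    have "Poly_Mapping.single m (lkp p m) = Poly_Mapping.single 0 (lkp p m) * monom m"
      by (simp add: monom_def mult_single)
    then show ?thesis
      using ideal_mult[OF assms(1) assms(3)[OF that], of "Poly_Mapping.single 0 (lkp p m)"]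
      by (simp add: Spoly_single)
  qed
  then have "(\<Sum>m\<in>keys p. Poly_Mapping.single m (lkp p m)) \<in> J"
    by (rule ideal_sum[OF assms(1)])
  then show ?thesis using poly_mapping_decompose[of p] by simp
qed

lemma monom_dvd_ideal:
  assumes "is_ideal n J" "monom k \<in> J" "lkp k \<le> lkp m" "keys m \<subseteq> {..<n}"
  shows "monom m \<in> J"
proof -
  have m: "m = (m - k) + k"
    by (rule poly_mapping_eqI) (use assms(3) in \<open>simp add: lookup_add lookup_minus le_fun_def\<close>)
  then have "keys (m - k) \<subseteq> {..<n}" using assms(4) keys_plus_nat[of "m - k" k] by auto
  then have "monom (m - k) * monom k \<in> J"
    using assms(1,2) Spoly_monom by (intro ideal_mult) auto
  then show ?thesis using m by (simp add: monom_mult)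
qed

lemma mono_ideal_ideal: "is_ideal n (mono_ideal n V :: 'a::field mpoly set)"
  unfolding is_ideal_def
proof (intro conjI ballI)
  show "mono_ideal n V \<subseteq> (Spoly n :: 'a mpoly set)" "0 \<in> (mono_ideal n V :: 'a mpoly set)" by (auto simp: mono_ideal_def)
next
  fix f g :: "'a mpoly"
  assume "f \<in> mono_ideal n V" "g \<in> mono_ideal n V"
  then show "f + g \<in> mono_ideal n V"
    using keys_add[of f g] unfolding mono_ideal_def by (blast intro: Spoly_add)
next
  fix f g :: "'a mpoly"
  assume f: "f \<in> mono_ideal n V" and g: "g \<in> Spoly n"
  have "\<exists>v\<in>V. v \<le> lkp m" if m: "m \<in> keys (g * f)" for m
  proof -
    obtain a b where ab: "m = a + b" "b \<in> keys f" using keys_mult[of g f] m by blast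
    then obtain v where "v \<in> V" "v \<le> lkp b" using f by (auto simp: mono_ideal_def)
    moreover have "lkp b \<le> lkp m" by (simp add: ab le_fun_def lookup_add)
    ultimately show ?thesis by (meson order_trans)
  qed
  then show "g * f \<in> mono_ideal n V" using f g by (simp add: mono_ideal_def Spoly_mult)
qed

lemma mono_ideal_subset_Spoly: "mono_ideal n V \<subseteq> Spoly n"
  by (auto simp: mono_ideal_def)

lemma monom_mono_ideal_iff: "monom m \<in> mono_ideal n V \<longleftrightarrow> keys m \<subseteq> {..<n} \<and> (\<exists>v\<in>V. v \<le> lkp m)"
  by (auto simp: mono_ideal_def Spoly_def)

lemma mono_ideal_memI_monomials: "p \<in> Spoly n \<Longrightarrow> (\<And>m. m \<in> keys p \<Longrightarrow> monom m \<in> mono_ideal n V) \<Longrightarrow> p \<in> mono_ideal n V"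
  by (auto simp: mono_ideal_def Spoly_def)

lemma mono_ideal_keys: "p \<in> mono_ideal n V \<Longrightarrow> m \<in> keys p \<Longrightarrow> monom m \<in> mono_ideal n V"
  by (auto simp: mono_ideal_def Spoly_def)

lemma mono_ideal_subsetI: "(\<And>v. v \<in> V \<Longrightarrow> \<exists>w\<in>W. w \<le> v) \<Longrightarrow> mono_ideal n V \<subseteq> mono_ideal n W"
  unfolding mono_ideal_def by (auto intro: order_trans) (meson order_trans)

lemma monomial_mono_ideal: "monomial_ideal n (mono_ideal n V :: 'a::field mpoly set)"
proof -
  let ?G = "{u. is_monomial n u \<and> u \<in> (mono_ideal n V :: 'a mpoly set)}"
  have "?G \<subseteq> Spoly n" using mono_ideal_subset_Spoly by auto
  then have id: "is_ideal n (ideal_gen n ?G)" by (rule is_ideal_gen)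
  have "p \<in> ideal_gen n ?G" if "p \<in> mono_ideal n V" for p :: "'a mpoly"
  proof (rule ideal_memI_monomials[OF id])
    show "p \<in> Spoly n" using that mono_ideal_subset_Spoly by auto
    fix m assume "m \<in> keys p"
    then have "monom m \<in> (mono_ideal n V :: 'a mpoly set)" using mono_ideal_keys that by blast
    then have "monom m \<in> ?G" by (auto simp: is_monomial_def monom_mono_ideal_iff)
    then show "monom m \<in> ideal_gen n ?G" by (rule subsetD[OF subset_ideal_gen])
  qed
  then have "mono_ideal n V \<subseteq> ideal_gen n ?G" by (rule subsetI)
  moreover have "ideal_gen n ?G \<subseteq> mono_ideal n V"
    by (rule ideal_gen_minimal[OF mono_ideal_ideal]) auto
  ultimately have "mono_ideal n V = ideal_gen n ?G" by (rule subset_antisym)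
  then show ?thesis unfolding monomial_ideal_def using mono_ideal_ideal by (intro conjI)
qed

lemma monomial_ideal_eq_gens:
  fixes I :: "'a::field mpoly set"
  assumes "monomial_ideal n I"
  shows "I = mono_ideal n {lkp m | m. keys m \<subseteq> {..<n} \<and> monom m \<in> I}" (is "I = mono_ideal n ?V")
proof
  have id: "is_ideal n I" using assms by (simp add: monomial_ideal_def)
  have "{u. is_monomial n u \<and> u \<in> I} \<subseteq> mono_ideal n ?V"
  proof
    fix u assume "u \<in> {u. is_monomial n u \<and> u \<in> I}"
    then obtain m where m: "keys m \<subseteq> {..<n}" "u = monom m" "monom m \<in> I"
      by (auto simp: is_monomial_def)
    then have "lkp m \<in> ?V" by blast
    then show "u \<in> mono_ideal n ?V" using m by (auto simp: monom_mono_ideal_iff)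
  qed
  then have "ideal_gen n {u. is_monomial n u \<and> u \<in> I} \<subseteq> mono_ideal n ?V"
    by (rule ideal_gen_minimal[OF mono_ideal_ideal])
  then show "I \<subseteq> mono_ideal n ?V" using assms by (simp add: monomial_ideal_def)
  show "mono_ideal n ?V \<subseteq> I"
  proof
    fix p :: "'a mpoly" assume p: "p \<in> mono_ideal n ?V"
    show "p \<in> I"
    proof (rule ideal_memI_monomials[OF id])
      show "p \<in> Spoly n" using p mono_ideal_subset_Spoly by auto
      fix m assume "m \<in> keys p"
      then have "keys m \<subseteq> {..<n}" "\<exists>v\<in>?V. v \<le> lkp m" using p by (auto simp: mono_ideal_def Spoly_def)
      then show "monom m \<in> I" using monom_dvd_ideal[OF id] by blast
    qed
  qed
qed

text \<open>By induction some finite F dominates M in the first n coordinates. It also dominates in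
  the last one wherever that coordinate is at least b, a bound for F. The values below b give
  finitely many slices, each treated by induction.\<close>

lemma dickson:
  fixes M :: "(nat \<Rightarrow> nat) set"
  shows "\<exists>F\<subseteq>M. finite F \<and> (\<forall>m\<in>M. \<exists>v\<in>F. \<forall>i<n. v i \<le> m i)"
proof (induction n arbitrary: M)
  case 0
  show ?case
  proof (cases "M = {}")
    case False
    then obtain m where "m \<in> M" by blast
    then show ?thesis by (intro exI[of _ "{m}"]) auto
  qed auto
next
  case (Suc n)
  obtain F where F: "F \<subseteq> M" "finite F" "\<And>m. m \<in> M \<Longrightarrow> \<exists>v\<in>F. \<forall>i<n. v i \<le> m i"
    using Suc[of M] by blast
  define b where "b = (\<Sum>v\<in>F. v n)"
  have "\<forall>k. \<exists>H. H \<subseteq> {m \<in> M. m n = k} \<and> finite H \<and> (\<forall>m\<in>{m \<in> M. m n = k}. \<exists>v\<in>H. \<forall>i<n. v i \<le> m i)"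
    using Suc by blast
  from choice[OF this] obtain H where "\<forall>k. H k \<subseteq> {m \<in> M. m n = k} \<and> finite (H k) \<and>
    (\<forall>m\<in>{m \<in> M. m n = k}. \<exists>v\<in>H k. \<forall>i<n. v i \<le> m i)" by blast
  then have H: "\<And>k. H k \<subseteq> {m \<in> M. m n = k}" "\<And>k. finite (H k)"
    "\<And>k m. m \<in> M \<Longrightarrow> m n = k \<Longrightarrow> \<exists>v\<in>H k. \<forall>i<n. v i \<le> m i" by auto
  show ?case
  proof (intro exI[of _ "F \<union> (\<Union>k<b. H k)"] conjI ballI)
    show "F \<union> (\<Union>k<b. H k) \<subseteq> M" using F(1) H(1) by blast
    show "finite (F \<union> (\<Union>k<b. H k))" using F(2) H(2) by simp
    fix m assume m: "m \<in> M"
    show "\<exists>v\<in>F \<union> (\<Union>k<b. H k). \<forall>i<Suc n. v i \<le> m i"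
    proof (cases "m n < b")
      case True
      obtain v where v: "v \<in> H (m n)" "\<forall>i<n. v i \<le> m i" using H(3)[OF m refl] by blast
      then have "v n = m n" using H(1)[of "m n"] by auto
      then show ?thesis using v True by (auto simp: less_Suc_eq)
    next
      case False
      obtain v where v: "v \<in> F" "\<forall>i<n. v i \<le> m i" using F(3)[OF m] by blast
      have "v n \<le> b" unfolding b_def using v F(2) by (intro member_le_sum) auto
      then show ?thesis using v False by (auto simp: less_Suc_eq)
    qed
  qed
qed

lemma monomial_ideal_finite:
  fixes I :: "'a::field mpoly set"
  assumes "monomial_ideal n I"
  obtains V where "finite V" "\<And>v. v \<in> V \<Longrightarrow> {i. 0 < v i} \<subseteq> {..<n}" "I = mono_ideal n V"
proof -
  define M where "M = {lkp m | m. keys m \<subseteq> {..<n} \<and> monom m \<in> I}"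
  have supp: "{i. 0 < v i} \<subseteq> {..<n}" if "v \<in> M" for v
    using that by (auto simp: M_def in_keys_iff subset_iff)
  obtain F where F: "F \<subseteq> M" "finite F" "\<And>m. m \<in> M \<Longrightarrow> \<exists>v\<in>F. \<forall>i<n. v i \<le> m i"
    using dickson[of M n] by blast
  have "\<exists>w\<in>F. w \<le> v" if "v \<in> M" for v
  proof -
    obtain w where w: "w \<in> F" "\<forall>i<n. w i \<le> v i" using F(3)[OF \<open>v \<in> M\<close>] by blast
    have "w i \<le> v i" for i
    proof (cases "i < n")
      case False
      have "{i. 0 < w i} \<subseteq> {..<n}" using supp[of w] w(1) F(1) by blast
      then have "w i = 0" using False by auto
      then show ?thesis by simp
    qed (use w in simp)
    then show ?thesis using w(1) by (auto simp: le_fun_def)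
  qed
  then have "mono_ideal n M \<subseteq> (mono_ideal n F :: 'a mpoly set)" by (rule mono_ideal_subsetI)
  moreover have "mono_ideal n F \<subseteq> (mono_ideal n M :: 'a mpoly set)" using F(1) by (intro mono_ideal_subsetI) auto
  ultimately have "I = mono_ideal n F" using monomial_ideal_eq_gens[OF assms] by (simp add: M_def)
  then show thesis using that[of F] F supp by blast
qed

section \<open>Primes, colon ideals and associated primes\<close>

lemma unit_vec_le_iff: "unit_vec i \<le> v \<longleftrightarrow> 0 < v i"
  by (auto simp: unit_vec_def le_fun_def of_bool_def Suc_le_eq)

lemma lookup_surj:
  fixes v :: "nat \<Rightarrow> nat"
  assumes "{i. 0 < v i} \<subseteq> {..<n}"
  obtains m where "lkp m = v" "keys m \<subseteq> {..<n}"
proof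
  have "finite {i. v i \<noteq> 0}" using assms finite_subset by fastforce
  then show "lkp (Abs_poly_mapping v) = v" by simp
  then show "keys (Abs_poly_mapping v) \<subseteq> {..<n}"
    using assms by (auto simp: in_keys_iff)
qed

lemma mono_ideal_least:
  fixes J :: "'a::field mpoly set"
  assumes "is_ideal n J" "\<And>v. v \<in> V \<Longrightarrow> \<exists>m. lkp m = v \<and> monom m \<in> J"
  shows "mono_ideal n V \<subseteq> J"
proof
  fix p :: "'a mpoly" assume p: "p \<in> mono_ideal n V"
  show "p \<in> J"
  proof (rule ideal_memI_monomials[OF assms(1)])
    show "p \<in> Spoly n" using p mono_ideal_subset_Spoly by auto
    fix m assume "m \<in> keys p"
    then have "keys m \<subseteq> {..<n}" "\<exists>v\<in>V. v \<le> lkp m" using p by (auto simp: mono_ideal_def Spoly_def)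
    then show "monom m \<in> J" using monom_dvd_ideal[OF assms(1)] assms(2) by blast
  qed
qed

lemma split_poly:
  fixes p :: "'a::field mpoly"
  assumes "p \<in> Spoly n"
  obtains q r where "p = q + r" "q \<in> Spoly n" "r \<in> Spoly n" "\<And>m. m \<in> keys q \<Longrightarrow> Q m" "\<And>m. m \<in> keys r \<Longrightarrow> \<not> Q m"
proof
  let ?t = "\<lambda>m. Poly_Mapping.single m (lkp p m)"
  have "p = sum ?t (keys p)" by (rule poly_mapping_decompose)
  also have "\<dots> = sum ?t ({m \<in> keys p. Q m} \<union> {m \<in> keys p. \<not> Q m})"
    by (rule sum.cong) auto
  also have "\<dots> = sum ?t {m \<in> keys p. Q m} + sum ?t {m \<in> keys p. \<not> Q m}"
    by (rule sum.union_disjoint) auto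
  finally show "p = sum ?t {m \<in> keys p. Q m} + sum ?t {m \<in> keys p. \<not> Q m}" .
  have keys_sum: "keys (sum ?t M) \<subseteq> M" for M
    using Poly_Mapping.keys_sum[of ?t M] by (auto simp: subset_iff split: if_splits)
  show "sum ?t {m \<in> keys p. Q m} \<in> Spoly n" "sum ?t {m \<in> keys p. \<not> Q m} \<in> Spoly n"
    using assms by (intro Spoly_sum Spoly_single; simp add: Spoly_def)+
  show "\<And>m. m \<in> keys (sum ?t {m \<in> keys p. Q m}) \<Longrightarrow> Q m"
    "\<And>m. m \<in> keys (sum ?t {m \<in> keys p. \<not> Q m}) \<Longrightarrow> \<not> Q m"
    using keys_sum by blast+
qed

lemma mono_ideal_vars_iff: "p \<in> mono_ideal n (unit_vec ` A) \<longleftrightarrow> p \<in> Spoly n \<and> (\<forall>m\<in>keys p. \<exists>i\<in>A. 0 < lkp m i)"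
  by (simp add: mono_ideal_def unit_vec_le_iff)

text \<open>Up to P each factor can be replaced by its part free of the variables in A. The product
  of two such parts is again free of them, so it lies in P only if it is zero, and polynomials form
  a domain.\<close>

lemma prime_ideal_vars: "prime_ideal n (mono_ideal n (unit_vec ` A) :: 'a::field mpoly set)"
proof -
  let ?P = "mono_ideal n (unit_vec ` A) :: 'a mpoly set"
  let ?Q = "\<lambda>m :: nat \<Rightarrow>\<^sub>0 nat. \<forall>i\<in>A. lkp m i = 0"
  have "1 \<notin> ?P" by (simp add: mono_ideal_vars_iff)
  moreover have "a \<in> ?P \<or> b \<in> ?P" if ab: "a \<in> Spoly n" "b \<in> Spoly n" "a * b \<in> ?P" for a b
  proof -
    obtain q r where a: "a = q + r" "q \<in> Spoly n" "r \<in> Spoly n" "\<And>m. m \<in> keys q \<Longrightarrow> ?Q m" "\<And>m. m \<in> keys r \<Longrightarrow> \<not> ?Q m"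
      by (rule split_poly[OF ab(1), of ?Q]) auto
    obtain s t where b: "b = s + t" "s \<in> Spoly n" "t \<in> Spoly n" "\<And>m. m \<in> keys s \<Longrightarrow> ?Q m" "\<And>m. m \<in> keys t \<Longrightarrow> \<not> ?Q m"
      by (rule split_poly[OF ab(2), of ?Q]) auto
    have r: "r \<in> ?P" and t: "t \<in> ?P" using a(3,5) b(3,5) by (auto simp: mono_ideal_vars_iff)
    have "q * s = a * b - (r * b + q * t)" by (simp add: a(1) b(1) algebra_simps)
    also have "\<dots> \<in> ?P"
      using ideal_diff[OF mono_ideal_ideal ab(3) ideal_add[OF mono_ideal_ideal ideal_mult_right[OF mono_ideal_ideal r ab(2)] ideal_mult[OF mono_ideal_ideal t a(2)]]] .
    finally have qs: "q * s \<in> ?P" .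
    have "keys (q * s) = {}"
    proof (rule ccontr)
      assume "keys (q * s) \<noteq> {}"
      then obtain m where m: "m \<in> keys (q * s)" by blast
      then obtain k l where "m = k + l" "k \<in> keys q" "l \<in> keys s" using keys_mult[of q s] by blast
      then have "?Q m" using a(4) b(4) by (simp add: lookup_add)
      then show False using qs m unfolding mono_ideal_vars_iff by fastforce
    qed
    then have "q * s = 0" by simp
    then have "q = 0 \<or> s = 0" by simp
    then show ?thesis using a(1) b(1) r t by auto
  qed
  ultimately show ?thesis
    unfolding prime_ideal_def proper_ideal_def using mono_ideal_ideal by blast
qed

lemma colon_mono_ideal:
  assumes "keys u \<subseteq> {..<n}"
  shows "colon n (mono_ideal n V) (monom u) = mono_ideal n ((\<lambda>v. v - lkp u) ` V)"
proof -
  have "v \<le> lkp (m + u) \<longleftrightarrow> v - lkp u \<le> lkp m" for v m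
    by (simp add: le_fun_def lookup_add le_diff_conv)
  then show ?thesis
    using Spoly_mult[OF _ Spoly_monom[OF assms]]
    by (auto simp: colon_def mono_ideal_def keys_times_monom)
qed

lemma add_gen_mono_ideal:
  fixes u :: "nat \<Rightarrow>\<^sub>0 nat"
  assumes "keys u \<subseteq> {..<n}" "\<And>v. v \<in> V \<Longrightarrow> {i. 0 < v i} \<subseteq> {..<n}"
  shows "add_gen n (mono_ideal n V) (monom u) = (mono_ideal n (insert (lkp u) V) :: 'a::field mpoly set)"
proof
  have "monom u \<in> mono_ideal n (insert (lkp u) V)" using assms(1) by (simp add: monom_mono_ideal_iff)
  moreover have "mono_ideal n V \<subseteq> mono_ideal n (insert (lkp u) V)" by (rule mono_ideal_subsetI) auto
  ultimately show "add_gen n (mono_ideal n V) (monom u) \<subseteq> (mono_ideal n (insert (lkp u) V) :: 'a mpoly set)"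
    unfolding add_gen_def by (intro ideal_gen_minimal[OF mono_ideal_ideal]) auto
  let ?G = "insert (monom u) (mono_ideal n V) :: 'a mpoly set"
  have "?G \<subseteq> Spoly n" using mono_ideal_subset_Spoly[of n V] Spoly_monom[OF assms(1)] by auto
  then have id: "is_ideal n (ideal_gen n ?G)" by (rule is_ideal_gen)
  show "mono_ideal n (insert (lkp u) V) \<subseteq> (add_gen n (mono_ideal n V) (monom u) :: 'a mpoly set)"
    unfolding add_gen_def
  proof (rule mono_ideal_least[OF id])
    fix v assume v: "v \<in> insert (lkp u) V"
    show "\<exists>m. lkp m = v \<and> monom m \<in> ideal_gen n ?G"
    proof (cases "v = lkp u")
      case True
      then show ?thesis using subset_ideal_gen[of ?G n] by auto
    next
      case False
      then have "v \<in> V" using v by simp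
      then obtain m where m: "lkp m = v" "keys m \<subseteq> {..<n}" using lookup_surj[OF assms(2)] by blast
      then have "monom m \<in> (mono_ideal n V :: 'a mpoly set)" using \<open>v \<in> V\<close> by (auto simp: monom_mono_ideal_iff)
      then show ?thesis using m(1) subset_ideal_gen[of ?G n] by auto
    qed
  qed
qed

text \<open>One variable is split off at a time; as 1 is not in P, some split-off variable must lie
  in P.\<close>

lemma prime_monom_var:
  fixes P :: "'a::field mpoly set"
  assumes P: "prime_ideal n P" and "monom m \<in> P"
  shows "\<exists>k<n. 0 < lkp m k \<and> var k \<in> P"
  using assms(2)
proof (induction "\<Sum>i<n. lkp m i" arbitrary: m rule: less_induct)
  case less
  have id: "is_ideal n P" and proper: "1 \<notin> P"
    using P by (auto simp: prime_ideal_def proper_ideal_def)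
  have "(monom m :: 'a mpoly) \<in> Spoly n" using less.prems ideal_subset[OF id] by blast
  then have km: "keys m \<subseteq> {..<n}" by (simp add: Spoly_def)
  have "m \<noteq> 0" using less.prems proper monom_eq_1 by metis
  then obtain i where i: "i \<in> keys m" by (metis all_not_in_conv keys_eq_empty)
  have "i < n" using i km by auto
  have "0 < lkp m i" using i by (simp add: in_keys_iff)
  define k where "k = m - Poly_Mapping.single i 1"
  have m: "m = k + Poly_Mapping.single i 1"
    unfolding k_def using \<open>0 < lkp m i\<close>
    by (intro poly_mapping_eqI) (auto simp: lookup_add lookup_minus lookup_single when_def)
  have "keys k \<subseteq> {..<n}" using km unfolding m keys_plus_nat by simp
  then have "monom k \<in> P \<or> var i \<in> P"
    using P less.prems \<open>i < n\<close> Spoly_monom Spoly_var unfolding m monom_mult[symmetric] prime_ideal_def var_def by blast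
  then show ?case
  proof
    assume k: "monom k \<in> P"
    have "(\<Sum>j<n. lkp k j) < (\<Sum>j<n. lkp m j)"
      using \<open>i < n\<close> unfolding m by (intro sum_strict_mono_ex1) (auto simp: lookup_add lookup_single when_def)
    then obtain j where "j < n" "0 < lkp k j" "var j \<in> P" using less.hyps k by blast
    then show ?thesis by (auto simp: m lookup_add)
  qed (use \<open>i < n\<close> \<open>0 < lkp m i\<close> in blast)
qed

section \<open>Primes generated by two variables\<close>

definition pair_primes :: "nat \<Rightarrow> ('a::field) mpoly set set" where
  "pair_primes n = {mono_ideal n {unit_vec i, unit_vec j} | i j. i < n \<and> j < n \<and> i \<noteq> j}"

text \<open>What the recursion retains of height 2: no prime generated by a single variable contains
  the ideal. Truncated subtraction preserves this, since zero exponents stay zero.\<close>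

definition coprime_gens :: "nat \<Rightarrow> (nat \<Rightarrow> nat) set \<Rightarrow> bool" where
  "coprime_gens n V \<longleftrightarrow> (\<forall>v\<in>V. {i. 0 < v i} \<subseteq> {..<n}) \<and> (\<forall>i<n. \<exists>v\<in>V. v i = 0)"

lemma prime_ideal_pair: "prime_ideal n (mono_ideal n {unit_vec i, unit_vec j})"
  using prime_ideal_vars[of n "{i, j}"] by simp

lemma var_mono_ideal_iff: "var k \<in> mono_ideal n V \<longleftrightarrow> k < n \<and> (\<exists>v\<in>V. v \<le> unit_vec k)"
  unfolding var_def monom_mono_ideal_iff lookup_single_unit by simp

lemma var_exponent: "var i \<in> J \<Longrightarrow> \<exists>m. lkp m = unit_vec i \<and> monom m \<in> J"
  unfolding var_def using lookup_single_unit by blast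

lemma var_pair_iff: "var k \<in> mono_ideal n {unit_vec i, unit_vec j} \<longleftrightarrow> k < n \<and> (k = i \<or> k = j)"
  by (auto simp: var_mono_ideal_iff unit_vec_le_iff) (auto simp: unit_vec_def)

text \<open>For every variable some generator avoids it, so a prime over the ideal contains a
  variable different from any given one. Below (x_i, x_j) this yields x_j and x_i in turn.\<close>

lemma pair_prime_minimal:
  fixes P :: "'a::field mpoly set"
  assumes V: "coprime_gens n V" and P: "P \<in> pair_primes n" and sub: "mono_ideal n V \<subseteq> P"
  shows "P \<in> min_primes n (mono_ideal n V)"
proof -
  obtain i j where ij: "i < n" "j < n" "i \<noteq> j" and Pij: "P = mono_ideal n {unit_vec i, unit_vec j}"
    using P by (auto simp: pair_primes_def)
  have min: "Q = P" if Q: "prime_ideal n Q" "mono_ideal n V \<subseteq> Q" "Q \<subseteq> P" for Q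
  proof
    have id: "is_ideal n Q" using Q(1) by (auto simp: prime_ideal_def proper_ideal_def)
    have other: "\<exists>k<n. k \<noteq> l \<and> var k \<in> Q" if l: "l < n" for l
    proof -
      obtain v where v: "v \<in> V" "v l = 0" using V l by (auto simp: coprime_gens_def)
      then obtain m where m: "lkp m = v" "keys m \<subseteq> {..<n}"
        using lookup_surj[of v n] V by (auto simp: coprime_gens_def)
      then have "monom m \<in> (mono_ideal n V :: 'a mpoly set)" using v(1) by (auto simp: monom_mono_ideal_iff)
      then have "monom m \<in> Q" using Q(2) by blast
      then show ?thesis using prime_monom_var[OF Q(1)] m(1) v(2) by force
    qed
    have sel: "k = i \<or> k = j" if "var k \<in> Q" for k
    proof -
      have "var k \<in> P" using that Q(3) by (rule subsetD[rotated])
      then show ?thesis by (simp add: Pij var_pair_iff)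
    qed
    have "var j \<in> Q" using other[OF ij(1)] sel by metis
    moreover have "var i \<in> Q" using other[OF ij(2)] sel by metis
    ultimately show "P \<subseteq> Q" unfolding Pij
      by (intro mono_ideal_least[OF id]) (auto intro: var_exponent)
  qed (use Q in blast)
  have "prime_ideal n P" unfolding Pij by (rule prime_ideal_pair)
  then show ?thesis unfolding min_primes_def using sub min by blast
qed

lemma min_primes_var_monom:
  fixes c :: "nat \<Rightarrow> nat"
  assumes "i < n" "c i = 0" "{k. 0 < c k} \<subseteq> {..<n}"
  shows "min_primes n (mono_ideal n {unit_vec i, c} :: 'a::field mpoly set) \<subseteq> pair_primes n"
proof
  fix P :: "'a mpoly set" assume "P \<in> min_primes n (mono_ideal n {unit_vec i, c})"
  then have P: "prime_ideal n P" "mono_ideal n {unit_vec i, c} \<subseteq> P"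
    "\<And>Q. prime_ideal n Q \<Longrightarrow> mono_ideal n {unit_vec i, c} \<subseteq> Q \<Longrightarrow> Q \<subseteq> P \<Longrightarrow> Q = P"
    by (auto simp: min_primes_def)
  have id: "is_ideal n P" using P(1) by (auto simp: prime_ideal_def proper_ideal_def)
  obtain m where m: "lkp m = c" "keys m \<subseteq> {..<n}" using lookup_surj[OF assms(3)] by blast
  then have "monom m \<in> (mono_ideal n {unit_vec i, c} :: 'a mpoly set)" by (simp add: monom_mono_ideal_iff)
  then have "monom m \<in> P" using P(2) by blast
  then obtain k where k: "k < n" "0 < c k" "var k \<in> P" using prime_monom_var[OF P(1)] m(1) by blast
  have "var i \<in> (mono_ideal n {unit_vec i, c} :: 'a mpoly set)" using assms(1) by (simp add: var_mono_ideal_iff)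
  then have "var i \<in> P" using P(2) by blast
  then have "mono_ideal n {unit_vec i, unit_vec k} \<subseteq> P"
    using k(3) by (intro mono_ideal_least[OF id]) (auto intro: var_exponent)
  moreover have "mono_ideal n {unit_vec i, c} \<subseteq> (mono_ideal n {unit_vec i, unit_vec k} :: 'a mpoly set)"
    using k(2) by (intro mono_ideal_subsetI) (auto simp: unit_vec_le_iff[of k])
  ultimately have "mono_ideal n {unit_vec i, unit_vec k} = P" using P(3)[OF prime_ideal_pair] by simp
  moreover have "i \<noteq> k" using k(2) assms(2) by auto
  ultimately show "P \<in> pair_primes n" using assms(1) k(1) by (auto simp: pair_primes_def)
qed

section \<open>Associated primes along I : u and I + Su\<close>

lemma add_gen_eq:
  fixes I :: "'a::field mpoly set"
  assumes I: "is_ideal n I" and u: "u \<in> Spoly n"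
  shows "add_gen n I u = {j + g * u | j g. j \<in> I \<and> g \<in> Spoly n}" (is "_ = ?R")
proof
  have "is_ideal n ?R"
    unfolding is_ideal_def
  proof (intro conjI ballI)
    show "?R \<subseteq> Spoly n" using ideal_subset[OF I] u by (auto intro!: Spoly_add Spoly_mult)
    show "0 \<in> ?R" using ideal_0[OF I] by (auto intro!: exI[of _ 0])
    fix f h :: "'a mpoly"
    assume "f \<in> ?R" "h \<in> ?R"
    then obtain j g j' g' where *: "f = j + g * u" "h = j' + g' * u" "j \<in> I" "j' \<in> I" "g \<in> Spoly n" "g' \<in> Spoly n" by blast
    then have "f + h = (j + j') + (g + g') * u" by (simp add: algebra_simps)
    then show "f + h \<in> ?R" using * ideal_add[OF I] Spoly_add by blast
  next
    fix f h :: "'a mpoly"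
    assume "f \<in> ?R" "h \<in> Spoly n"
    then obtain j g where *: "f = j + g * u" "j \<in> I" "g \<in> Spoly n" by blast
    then have "h * f = h * j + (h * g) * u" by (simp add: algebra_simps)
    then show "h * f \<in> ?R" using * ideal_mult[OF I] Spoly_mult \<open>h \<in> Spoly n\<close> by blast
  qed
  moreover have "insert u I \<subseteq> ?R"
  proof
    fix f assume "f \<in> insert u I"
    then consider "f = u" | "f \<in> I" by blast
    then show "f \<in> ?R"
    proof cases
      case 1
      then have "f = 0 + 1 * u" by simp
      then show ?thesis using ideal_0[OF I] Spoly_1 by blast
    next
      case 2
      have "f = f + 0 * u" by simp
      then show ?thesis using 2 Spoly_0 by blast
    qed
  qed
  ultimately show "add_gen n I u \<subseteq> ?R"
    unfolding add_gen_def by (rule ideal_gen_minimal)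
  have "insert u I \<subseteq> Spoly n" using u ideal_subset[OF I] by blast
  then have id: "is_ideal n (add_gen n I u)" unfolding add_gen_def by (rule is_ideal_gen)
  have "u \<in> add_gen n I u" "I \<subseteq> add_gen n I u"
    using subset_ideal_gen[of "insert u I" n] by (auto simp: add_gen_def)
  then show "?R \<subseteq> add_gen n I u" using ideal_add[OF id] ideal_mult[OF id] by blast
qed

lemma ass_primes_prime: "prime_ideal n Q \<Longrightarrow> ass_primes n Q \<subseteq> {Q}"
proof
  fix P assume Q: "prime_ideal n Q" and "P \<in> ass_primes n Q"
  then obtain f where f: "prime_ideal n P" "f \<in> Spoly n" "P = colon n Q f" by (auto simp: ass_primes_def)
  have id: "is_ideal n Q" using Q by (auto simp: prime_ideal_def proper_ideal_def)
  have "1 \<notin> P" using f(1) by (auto simp: prime_ideal_def proper_ideal_def)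
  then have "f \<notin> Q" using f(3) by (simp add: colon_def)
  then have "P = Q"
    using Q f(2,3) ideal_subset[OF id] ideal_mult_right[OF id] unfolding colon_def prime_ideal_def by blast
  then show "P \<in> {Q}" by simp
qed

text \<open>The sequence 0 -> S/(I : u) -> S/I -> S/(I + Su) -> 0 by hand. The class of f generates
  a copy of S/P, in which every nonzero element has annihilator P. Either some nonzero multiple of f
  is congruent to h * u modulo I, and then h has annihilator P modulo I : u, or f keeps its
  annihilator modulo I + Su.\<close>

lemma ass_primes_split:
  assumes I: "is_ideal n I" and u: "u \<in> Spoly n"
  shows "ass_primes n I \<subseteq> ass_primes n (colon n I u) \<union> ass_primes n (add_gen n I u)"
proof
  fix P assume "P \<in> ass_primes n I"
  then obtain f where P: "prime_ideal n P" and f: "f \<in> Spoly n" and Pf: "P = colon n I f"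
    by (auto simp: ass_primes_def)
  show "P \<in> ass_primes n (colon n I u) \<union> ass_primes n (add_gen n I u)"
  proof (cases "\<exists>g\<in>Spoly n. g * f \<notin> I \<and> g * f \<in> add_gen n I u")
    case True
    then obtain g where g: "g \<in> Spoly n" "g * f \<notin> I" "g * f \<in> add_gen n I u" by blast
    then obtain j h where h: "g * f = j + h * u" "j \<in> I" "h \<in> Spoly n"
      unfolding add_gen_eq[OF I u] by blast
    have "P = colon n (colon n I u) h"
    proof
      show "P \<subseteq> colon n (colon n I u) h"
      proof
        fix k assume k: "k \<in> P"
        then have kS: "k \<in> Spoly n" and "k * f \<in> I" by (auto simp: Pf colon_def)
        then have "g * (k * f) \<in> I" using ideal_mult[OF I] g(1) by blast
        then have "g * (k * f) - k * j \<in> I" using ideal_diff[OF I] ideal_mult[OF I h(2) kS] by blast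
        moreover have "g * (k * f) - k * j = k * h * u"
        proof -
          have "g * (k * f) = k * (g * f)" by (simp add: ac_simps)
          then show ?thesis unfolding h(1) by (simp add: algebra_simps)
        qed
        ultimately show "k \<in> colon n (colon n I u) h" using kS h(3) by (simp add: colon_def Spoly_mult)
      qed
      show "colon n (colon n I u) h \<subseteq> P"
      proof
        fix k assume "k \<in> colon n (colon n I u) h"
        then have k: "k \<in> Spoly n" "k * h * u \<in> I" by (auto simp: colon_def)
        have "k * g * f = k * h * u + k * j"
        proof -
          have "k * g * f = k * (g * f)" by (simp add: ac_simps)
          then show ?thesis unfolding h(1) by (simp add: algebra_simps)
        qed
        then have "k * g * f \<in> I" using k(2) ideal_add[OF I] ideal_mult[OF I h(2) k(1)] by simp
        then have "k * g \<in> P" using k(1) g(1) by (simp add: Pf colon_def Spoly_mult)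
        moreover have "g \<notin> P" using g(2) by (simp add: Pf colon_def)
        ultimately show "k \<in> P" using P k(1) g(1) by (auto simp: prime_ideal_def)
      qed
    qed
    then show ?thesis using P h(3) by (auto simp: ass_primes_def)
  next
    case False
    have "I \<subseteq> add_gen n I u" using subset_ideal_gen[of "insert u I" n] by (auto simp: add_gen_def)
    then have "P = colon n (add_gen n I u) f" using False unfolding Pf colon_def by blast
    then show ?thesis using P f by (auto simp: ass_primes_def)
  qed
qed

section \<open>Cleanness\<close>

text \<open>The second conjunct is the induction invariant from which the absence of embedded primes
  is derived at each step, through \<open>pair_prime_minimal\<close>.\<close>

definition good_ideal :: "nat \<Rightarrow> ('a::field) mpoly set \<Rightarrow> bool" where
  "good_ideal n I \<longleftrightarrow> k_clean n 0 I \<and> ass_primes n I \<subseteq> pair_primes n"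

text \<open>The associated primes of I come from the colon and the sum, so they are generated by two
  variables and are minimal over I by coprimality. The same holds for the minimal primes of (x_i,
  x^c), which contain I; hence x_i is a cleaner.\<close>

lemma good_ideal_step:
  fixes V :: "(nat \<Rightarrow> nat) set"
  assumes V: "coprime_gens n V" "(\<lambda>_. 0) \<notin> V" and i: "i < n"
    and notin: "\<And>v. v \<in> V \<Longrightarrow> \<not> v \<le> unit_vec i"
    and c: "c i = 0" "{k. 0 < c k} \<subseteq> {..<n}"
    and add: "mono_ideal n (insert (unit_vec i) V) = (mono_ideal n {unit_vec i, c} :: 'a::field mpoly set)"
    and good: "good_ideal n (mono_ideal n {unit_vec i, c} :: 'a mpoly set)"
      "good_ideal n (mono_ideal n ((\<lambda>v. v - unit_vec i) ` V) :: 'a mpoly set)"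
  shows "good_ideal n (mono_ideal n V :: 'a mpoly set)"
proof -
  let ?I = "mono_ideal n V :: 'a mpoly set"
  let ?m = "Poly_Mapping.single i 1 :: nat \<Rightarrow>\<^sub>0 nat"
  have m: "keys ?m \<subseteq> {..<n}" using i by simp
  have colon: "colon n ?I (var i) = mono_ideal n ((\<lambda>v. v - unit_vec i) ` V)"
    using colon_mono_ideal[OF m] unfolding var_def lookup_single_unit .
  have addg: "add_gen n ?I (var i) = mono_ideal n {unit_vec i, c}"
  proof -
    have "\<And>v. v \<in> V \<Longrightarrow> {i. 0 < v i} \<subseteq> {..<n}" using V(1) by (simp add: coprime_gens_def)
    then have "add_gen n ?I (var i) = mono_ideal n (insert (unit_vec i) V)"
      unfolding var_def using add_gen_mono_ideal[OF m] unfolding lookup_single_unit by blast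
    then show ?thesis by (simp only: add)
  qed
  have ass: "ass_primes n ?I \<subseteq> pair_primes n"
    using ass_primes_split[of n ?I "var i", OF mono_ideal_ideal Spoly_var[OF i]] good
    unfolding colon addg good_ideal_def by blast
  have sub: "?I \<subseteq> P" if "P \<in> ass_primes n ?I" for P
    using that ideal_mult_right[OF mono_ideal_ideal[of n V]] mono_ideal_subset_Spoly[of n V]
    by (auto simp: ass_primes_def colon_def)
  have "no_embedded_primes n ?I"
    unfolding no_embedded_primes_def using pair_prime_minimal[OF V(1)] ass sub by blast
  moreover have "cleaner_monomial n ?I (var i)"
    unfolding cleaner_monomial_def
  proof (intro conjI)
    show "is_monomial n (var i :: 'a mpoly)" unfolding is_monomial_def var_def using m by blast
    show "var i \<noteq> (1 :: 'a mpoly)"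
      unfolding var_def monom_eq_1 by (metis lookup_single_eq lookup_zero zero_neq_one)
    show "var i \<notin> ?I" using notin by (simp add: var_mono_ideal_iff)
    have "mono_ideal n V \<subseteq> (mono_ideal n {unit_vec i, c} :: 'a mpoly set)"
      unfolding add[symmetric] by (rule mono_ideal_subsetI) auto
    then have "?I \<subseteq> P" if "P \<in> min_primes n (mono_ideal n {unit_vec i, c})" for P
      using that by (auto simp: min_primes_def)
    then show "min_primes n (add_gen n ?I (var i)) \<subseteq> min_primes n ?I"
      unfolding addg using pair_prime_minimal[OF V(1)] min_primes_var_monom[OF i c] by blast
  qed
  moreover have "card (supp (var i :: 'a mpoly)) \<le> 0 + 1"
    by (simp add: var_def supp_monom)
  moreover have "proper_ideal n ?I"
  proof -
    have "1 \<notin> ?I"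
    proof
      assume "1 \<in> ?I"
      then obtain v where "v \<in> V" "v \<le> lkp (0 :: nat \<Rightarrow>\<^sub>0 nat)" by (auto simp: mono_ideal_def)
      then have "v = (\<lambda>_. 0)" by (auto simp: le_fun_def)
      then show False using \<open>v \<in> V\<close> V(2) by simp
    qed
    then show ?thesis using mono_ideal_ideal by (simp add: proper_ideal_def)
  qed
  ultimately have "k_clean n 0 ?I"
    using k_clean.step[of n ?I "var i" 0, OF monomial_mono_ideal] good unfolding colon addg good_ideal_def by blast
  then show ?thesis using ass by (simp add: good_ideal_def)
qed

text \<open>A variable x_j dividing x^c serves as cleaner: adding it gives the prime (x_i, x_j), and
  the colon by it lowers the exponent of x_j in x^c by one.\<close>

lemma good_ideal_var_monom:
  fixes c :: "nat \<Rightarrow> nat"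
  assumes "i < n" "c i = 0" "c \<noteq> (\<lambda>_. 0)" "{k. 0 < c k} \<subseteq> {..<n}"
  shows "good_ideal n (mono_ideal n {unit_vec i, c} :: 'a::field mpoly set)"
  using assms(2-)
proof (induction "\<Sum>k<n. c k" arbitrary: c rule: less_induct)
  case less
  obtain j where j: "0 < c j" using less.prems(2) by (auto simp: fun_eq_iff)
  then have ij: "j \<noteq> i" "j < n" using less.prems by (auto intro: ccontr)
  have single: "good_ideal n (mono_ideal n {unit_vec k, unit_vec l} :: 'a mpoly set)" if "k < n" "l < n" "k \<noteq> l" for k l
  proof -
    let ?P = "mono_ideal n {unit_vec k, unit_vec l} :: 'a mpoly set"
    have P: "prime_ideal n ?P" by (rule prime_ideal_pair)
    then have "proper_ideal n ?P" by (simp add: prime_ideal_def)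
    then have "k_clean n 0 ?P" using monomial_mono_ideal P by (intro k_clean.prime)
    moreover have "ass_primes n ?P \<subseteq> {?P}" by (rule ass_primes_prime[OF P])
    moreover have "?P \<in> pair_primes n" using that by (auto simp: pair_primes_def)
    ultimately show ?thesis by (auto simp: good_ideal_def)
  qed
  have uj: "unit_vec j \<le> c" using j by (simp add: unit_vec_le_iff)
  show ?case
  proof (cases "c = unit_vec j")
    case True
    then show ?thesis using single[of i j] assms(1) ij by simp
  next
    case False
    show ?thesis
    \<comment> \<open>The roles are exchanged: x_j is the cleaner, and x_i takes the place of the
      monomial x^c.\<close>
    proof (rule good_ideal_step[where i = j and c = "unit_vec i"])
      show "coprime_gens n {unit_vec i, c}"
        using assms(1) less.prems by (auto simp: coprime_gens_def unit_vec_def split: if_splits)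
      show "(\<lambda>_. 0) \<notin> {unit_vec i, c}" using less.prems(2) by (auto simp: unit_vec_def fun_eq_iff)
      show "j < n" by (rule ij)
      show "\<not> v \<le> unit_vec j" if "v \<in> {unit_vec i, c}" for v
        using that
      proof safe
        assume "unit_vec i \<le> unit_vec j"
        then show False using ij by (simp add: unit_vec_le_iff) (simp add: unit_vec_def)
      next
        assume "c \<le> unit_vec j"
        then show False using uj False by (simp add: antisym)
      qed
      show "unit_vec i j = 0" using ij by (simp add: unit_vec_def)
      show "{k. 0 < unit_vec i k} \<subseteq> {..<n}" using assms(1) by (auto simp: unit_vec_def)
      show "mono_ideal n (insert (unit_vec j) {unit_vec i, c}) = (mono_ideal n {unit_vec j, unit_vec i} :: 'a mpoly set)"
        by (intro subset_antisym mono_ideal_subsetI) (use uj in auto)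
      show "good_ideal n (mono_ideal n {unit_vec j, unit_vec i} :: 'a mpoly set)"
        using single[of j i] ij assms(1) by simp
      have "unit_vec i - unit_vec j = unit_vec i"
        using ij by (auto simp: unit_vec_def fun_eq_iff)
      moreover have "good_ideal n (mono_ideal n {unit_vec i, c - unit_vec j} :: 'a mpoly set)"
      proof (rule less.hyps)
        show "(\<Sum>k<n. (c - unit_vec j) k) < (\<Sum>k<n. c k)"
          using ij j by (intro sum_strict_mono_ex1) (auto simp: unit_vec_def intro!: bexI[of _ j])
        show "(c - unit_vec j) i = 0" using less.prems(1) by simp
        show "c - unit_vec j \<noteq> (\<lambda>_. 0)"
        proof
          assume "c - unit_vec j = (\<lambda>_. 0)"
          then have "c \<le> unit_vec j" by (simp add: fun_eq_iff le_fun_def)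
          then show False using uj False by (simp add: antisym)
        qed
        have "{k. 0 < (c - unit_vec j) k} \<subseteq> {k. 0 < c k}" by auto
        then show "{k. 0 < (c - unit_vec j) k} \<subseteq> {..<n}" using less.prems(3) by (rule subset_trans)
      qed
      ultimately show "good_ideal n (mono_ideal n ((\<lambda>v. v - unit_vec j) ` {unit_vec i, c}) :: 'a mpoly set)"
        by simp
    qed
  qed
qed

lemma principal_tree_good_ideal:
  assumes "principal_tree V" "coprime_gens n V" "(\<lambda>_. 0) \<notin> V"
  shows "good_ideal n (mono_ideal n V :: 'a::field mpoly set)"
  using assms
\<comment> \<open>With \<open>Suc\<close> the sum decreases whenever a generator is dropped,
  whatever its exponents; generators merged by a colon only lower it further.\<close>
proof (induction "\<Sum>v\<in>V. Suc (\<Sum>i<n. v i)" arbitrary: V rule: less_induct)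
  case less
  from less.prems(1) show ?case
  proof (cases rule: principal_tree_cases)
    case (single v)
    \<comment> \<open>A single generator divisible by no variable would be 1.\<close>
    have "v i = 0" for i
    proof (cases "i < n")
      case False
      have "{i. 0 < v i} \<subseteq> {..<n}" using less.prems(2) single by (simp add: coprime_gens_def)
      then show ?thesis using False by auto
    qed (use less.prems(2) single in \<open>simp add: coprime_gens_def\<close>)
    then have "v = (\<lambda>_. 0)" by (simp add: fun_eq_iff)
    then show ?thesis using less.prems(3) single by simp
  next
    case (leaf W u p)
    have finV: "finite V" using less.prems(1) by (rule principal_tree_finite)
    then have finW: "finite W" using leaf by simp
    have supp: "{i. 0 < v i} \<subseteq> {..<n}" if "v \<in> V" for v
      using less.prems(2) that by (simp add: coprime_gens_def)
    show ?thesis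
    proof (cases "p \<le> u")
      case True
      have "mono_ideal n V = (mono_ideal n W :: 'a mpoly set)"
        using True leaf by (intro subset_antisym mono_ideal_subsetI) auto
      moreover have "(\<Sum>v\<in>W. Suc (\<Sum>i<n. v i)) < (\<Sum>v\<in>V. Suc (\<Sum>i<n. v i))"
        using leaf finW by simp
      moreover have "coprime_gens n W"
        unfolding coprime_gens_def
      proof (intro conjI ballI allI impI)
        fix i assume "i < n"
        then obtain v where v: "v \<in> V" "v i = 0" using less.prems(2) by (auto simp: coprime_gens_def)
        have "p i \<le> u i" using True by (simp add: le_fun_def)
        then show "\<exists>v\<in>W. v i = 0" using v leaf by (cases "v = u") auto
      qed (use supp leaf in auto)
      ultimately show ?thesis using less.hyps[of W] leaf less.prems(3) by simp
    next
      case False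
      then obtain i where i: "u i < p i" by (auto simp: le_fun_def not_le)
      have "p \<in> V" using leaf by simp
      then have "{i. 0 < p i} \<subseteq> {..<n}" by (rule supp)
      moreover have "i \<in> {i. 0 < p i}" using i by simp
      ultimately have "i < n" by blast
      have pos: "u i < l i" if "l \<in> W" for l
      proof -
        have "p i \<le> max (u i) (l i)" using leaf(5)[OF that] by (simp add: le_fun_def sup_max)
        then show ?thesis using i by linarith
      qed
      obtain v where v: "v \<in> V" "v i = 0" using less.prems(2) \<open>i < n\<close> by (auto simp: coprime_gens_def)
      then have "v = u" using pos[of v] leaf(1) by auto
      then have ui: "u i = 0" using v(2) by simp
      have "u \<noteq> (\<lambda>_. 0)" using less.prems(3) leaf by auto
      have "u \<in> V" using leaf by simp
      have add: "mono_ideal n (insert (unit_vec i) V) = (mono_ideal n {unit_vec i, u} :: 'a mpoly set)"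
      proof (intro subset_antisym mono_ideal_subsetI)
        fix v assume "v \<in> insert (unit_vec i) V"
        then have "v = unit_vec i \<or> v = u \<or> v \<in> W" using leaf by auto
        moreover have "unit_vec i \<le> v" if "v \<in> W" using pos[OF that] by (simp add: unit_vec_le_iff)
        ultimately show "\<exists>w\<in>{unit_vec i, u}. w \<le> v" by auto
      qed (use leaf in auto)
      have goodu: "good_ideal n (mono_ideal n {unit_vec i, u} :: 'a mpoly set)"
        by (rule good_ideal_var_monom[OF \<open>i < n\<close> ui \<open>u \<noteq> (\<lambda>_. 0)\<close> supp[OF \<open>u \<in> V\<close>]])
      show ?thesis
      \<comment> \<open>If x_i already lies in I it cannot be a cleaner, but then I itself is (x_i,
        u).\<close>
      proof (cases "\<exists>v\<in>V. v \<le> unit_vec i")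
        case True
        then have "mono_ideal n V = (mono_ideal n (insert (unit_vec i) V) :: 'a mpoly set)"
          by (intro subset_antisym mono_ideal_subsetI) auto
        then show ?thesis using goodu add by simp
      next
        case False
        let ?f = "\<lambda>v. v - unit_vec i"
        have "good_ideal n (mono_ideal n (?f ` V) :: 'a mpoly set)"
        proof (rule less.hyps)
          have "(\<Sum>v\<in>?f ` V. Suc (\<Sum>k<n. v k)) \<le> (\<Sum>v\<in>V. Suc (\<Sum>k<n. ?f v k))"
            using sum_image_le[OF finV, of "\<lambda>v. Suc (\<Sum>k<n. v k)" ?f] by (simp add: o_def)
          \<comment> \<open>Strict because the exponent of x_i in p is positive.\<close>
          also have "\<dots> < (\<Sum>v\<in>V. Suc (\<Sum>k<n. v k))"
          proof (rule sum_strict_mono_ex1[OF finV])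
            have "(\<Sum>k<n. ?f p k) < (\<Sum>k<n. p k)"
              using i \<open>i < n\<close> by (intro sum_strict_mono_ex1) (auto simp: unit_vec_def intro!: bexI[of _ i])
            then show "\<exists>v\<in>V. Suc (\<Sum>k<n. ?f v k) < Suc (\<Sum>k<n. v k)" using \<open>p \<in> V\<close> by auto
          qed (auto intro: sum_mono)
          finally show "(\<Sum>v\<in>?f ` V. Suc (\<Sum>k<n. v k)) < (\<Sum>v\<in>V. Suc (\<Sum>k<n. v k))" .
          show "principal_tree (?f ` V)" by (rule principal_tree_diff_image[OF less.prems(1)])
          show "coprime_gens n (?f ` V)"
            unfolding coprime_gens_def
          proof (intro conjI ballI allI impI)
            fix w assume "w \<in> ?f ` V"
            then obtain v where v: "v \<in> V" "w = ?f v" by blast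
            have "{k. 0 < w k} \<subseteq> {k. 0 < v k}" unfolding v(2) by auto
            then show "{k. 0 < w k} \<subseteq> {..<n}" using supp[OF v(1)] by (rule subset_trans)
          next
            fix k assume "k < n"
            then obtain v where "v \<in> V" "v k = 0" using less.prems(2) by (auto simp: coprime_gens_def)
            then show "\<exists>w\<in>?f ` V. w k = 0" by (intro bexI[of _ "?f v"]) auto
          qed
          show "(\<lambda>_. 0) \<notin> ?f ` V"
          proof
            assume "(\<lambda>_. 0) \<in> ?f ` V"
            then obtain v where v: "v \<in> V" "?f v = (\<lambda>_. 0)" by force
            then have "v \<le> unit_vec i" by (simp add: fun_eq_iff le_fun_def)
            then show False using False v(1) by blast
          qed
        qed
        then show ?thesis
          using False by (intro good_ideal_step[OF less.prems(2,3) \<open>i < n\<close> _ ui supp[OF \<open>u \<in> V\<close>] add goodu]) auto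
      qed
    qed
  qed
qed

section \<open>Regular sequences\<close>

text \<open>Vanishing of the k-th Koszul homology of the variables with coefficients in S/J,
  expressed by representatives in S.\<close>

definition koszul_exact :: "nat \<Rightarrow> ('a::field) mpoly set \<Rightarrow> nat \<Rightarrow> bool" where
  "koszul_exact n J k \<longleftrightarrow> (\<forall>z. koszul_chain {..<n} k z \<longrightarrow> (\<forall>T. z T \<in> Spoly n) \<longrightarrow>
     (\<forall>T. koszul_bd {..<n} var z T \<in> J) \<longrightarrow>
     (\<exists>y. koszul_chain {..<n} (Suc k) y \<and> (\<forall>T. y T \<in> Spoly n) \<and> (\<forall>T. z T - koszul_bd {..<n} var y T \<in> J)))"

lemma koszul_sign_cases: "koszul_sign j T = 1 \<or> koszul_sign j T = (- 1 :: 'r::comm_ring_1)"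
  unfolding koszul_sign_def by (cases "even (card {k \<in> T. k < j})") simp_all

lemma koszul_sign_mult_ideal:
  fixes p :: "'a::field mpoly"
  assumes "is_ideal n J" "p \<in> J"
  shows "koszul_sign j T * p \<in> J"
proof -
  have "koszul_sign j T * p = p \<or> koszul_sign j T * p = - p"
    using koszul_sign_cases[of j T, where 'r = "'a mpoly"] by auto
  then show ?thesis using assms ideal_uminus[OF assms] by auto
qed

lemma koszul_bd_ideal:
  assumes "is_ideal n J" "\<And>T. z T \<in> J"
  shows "koszul_bd {..<n} var z T \<in> J"
  unfolding koszul_bd_def
proof (rule ideal_sum[OF assms(1)])
  fix j assume "j \<in> {..<n} - T"
  then have "var j * z (insert j T) \<in> J" using ideal_mult[OF assms(1) assms(2) Spoly_var] by simp
  then show "koszul_sign j T * var j * z (insert j T) \<in> J"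
    unfolding mult.assoc by (rule koszul_sign_mult_ideal[OF assms(1)])
qed

lemma koszul_wedge_ideal:
  assumes "is_ideal n J" "\<And>T. z T \<in> J"
  shows "koszul_wedge i z T \<in> J"
  unfolding koszul_wedge_def using koszul_sign_mult_ideal[OF assms(1) assms(2)] ideal_0[OF assms(1)] by simp

lemma koszul_exact_trivial:
  assumes "is_ideal n J" "n < k"
  shows "koszul_exact n J k"
  unfolding koszul_exact_def
proof (intro allI impI)
  fix z :: "nat set \<Rightarrow> 'a mpoly"
  assume z: "koszul_chain {..<n} k z"
  have "z T = 0" for T
  proof (rule ccontr)
    assume "z T \<noteq> 0"
    then have "T \<subseteq> {..<n}" "card T = k" using z by (auto simp: koszul_chain_def)
    then show False using card_mono[of "{..<n}" T] assms(2) by simp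
  qed
  then show "\<exists>y. koszul_chain {..<n} (Suc k) y \<and> (\<forall>T. y T \<in> Spoly n) \<and> (\<forall>T. z T - koszul_bd {..<n} var y T \<in> J)"
    using ideal_0[OF assms(1)] by (intro exI[of _ "\<lambda>_. 0"]) (simp add: koszul_chain_def)
qed

lemma max_ideal_decompose:
  fixes f :: "'a::field mpoly"
  assumes "f \<in> max_ideal n"
  shows "\<exists>g. (\<forall>i. g i \<in> Spoly n) \<and> f = (\<Sum>i<n. g i * var i)"
proof -
  let ?J = "{(\<Sum>i<n. g i * var i) | g. \<forall>i. g i \<in> Spoly n} :: 'a mpoly set"
  have J: "is_ideal n ?J"
    unfolding is_ideal_def
  proof (intro conjI ballI)
    show "?J \<subseteq> Spoly n" by (auto intro!: Spoly_sum Spoly_mult Spoly_var)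
    show "0 \<in> ?J" by (intro CollectI exI[of _ "\<lambda>_. 0"]) simp
    fix p q :: "'a mpoly" assume "p \<in> ?J" "q \<in> ?J"
    then obtain g h where gh: "p = (\<Sum>i<n. g i * var i)" "q = (\<Sum>i<n. h i * var i)"
      "\<forall>i. g i \<in> Spoly n" "\<forall>i. h i \<in> Spoly n" by blast
    then have "p + q = (\<Sum>i<n. (g i + h i) * var i)" "\<forall>i. g i + h i \<in> Spoly n"
      by (simp_all add: distrib_right sum.distrib Spoly_add)
    then show "p + q \<in> ?J" by (intro CollectI exI[of _ "\<lambda>i. g i + h i"] conjI)
  next
    fix p q :: "'a mpoly" assume "p \<in> ?J" and q: "q \<in> Spoly n"
    then obtain g where g: "p = (\<Sum>i<n. g i * var i)" "\<forall>i. g i \<in> Spoly n" by blast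
    then have "q * p = (\<Sum>i<n. (q * g i) * var i)" "\<forall>i. q * g i \<in> Spoly n"
      using q by (simp_all add: sum_distrib_left mult.assoc Spoly_mult)
    then show "q * p \<in> ?J" by (intro CollectI exI[of _ "\<lambda>i. q * g i"] conjI)
  qed
  have "mono_ideal n (unit_vec ` {..<n}) \<subseteq> ?J"
  proof (rule mono_ideal_least[OF J])
    fix v assume "v \<in> unit_vec ` {..<n}"
    then obtain i where i: "i < n" "v = unit_vec i" by auto
    have "(\<Sum>j<n. of_bool (j = i) * var j) = (\<Sum>j<n. if j = i then var i else 0 :: 'a mpoly)"
      by (rule sum.cong) auto
    then have "(var i :: 'a mpoly) = (\<Sum>j<n. of_bool (j = i) * var j)" using i(1) by simp
    moreover have "\<forall>j. of_bool (j = i) \<in> (Spoly n :: 'a mpoly set)" by simp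
    ultimately have "var i \<in> ?J" by (intro CollectI exI[of _ "\<lambda>j. of_bool (j = i)"] conjI)
    then show "\<exists>m. lkp m = v \<and> monom m \<in> ?J" unfolding i(2) by (rule var_exponent)
  qed
  moreover have "f \<in> mono_ideal n (unit_vec ` {..<n})"
    unfolding mono_ideal_vars_iff
  proof (intro conjI ballI)
    show f: "f \<in> Spoly n" using assms by (simp add: max_ideal_def)
    fix m assume m: "m \<in> keys f"
    then have "m \<noteq> 0" using assms by (auto simp: max_ideal_def in_keys_iff)
    then obtain i where "i \<in> keys m" by (metis all_not_in_conv keys_eq_empty)
    moreover from this have "i < n" using f m by (auto simp: Spoly_def)
    ultimately show "\<exists>i\<in>{..<n}. 0 < lkp m i" by (auto simp: in_keys_iff)
  qed
  ultimately show ?thesis by blast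
qed

text \<open>The homology of the Koszul complex is annihilated by the maximal ideal, so a cycle modulo
  \<open>J\<close> times \<open>f\<close> bounds some \<open>w\<close>, which is a cycle modulo \<open>J + (f)\<close> one degree higher.\<close>

lemma koszul_exact_regular:
  fixes f :: "'a::field mpoly"
  assumes J: "is_ideal n J" and f: "f \<in> max_ideal n"
    and nzd: "\<And>g. g \<in> Spoly n \<Longrightarrow> g * f \<in> J \<Longrightarrow> g \<in> J"
    and exact: "koszul_exact n (add_gen n J f) (Suc k)"
  shows "koszul_exact n J k"
  unfolding koszul_exact_def
proof (intro allI impI)
  fix z :: "nat set \<Rightarrow> 'a mpoly"
  assume z: "koszul_chain {..<n} k z" "\<forall>T. z T \<in> Spoly n" "\<forall>T. koszul_bd {..<n} var z T \<in> J"
  let ?N = "{..<n}"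
  have fS: "f \<in> Spoly n" using f by (simp add: max_ideal_def)
  obtain g where g: "\<And>i. g i \<in> Spoly n" "f = (\<Sum>i<n. g i * var i)"
    using max_ideal_decompose[OF f] by blast
  \<comment> \<open>The homotopies of the single variables combine to one for f. The error r stays
    in J because z is a cycle modulo J.\<close>
  define w where "w T = (\<Sum>i<n. g i * koszul_wedge i z T)" for T
  define r where "r T = (\<Sum>i<n. g i * koszul_wedge i (koszul_bd ?N var z) T)" for T
  have kw: "koszul_bd ?N var (koszul_wedge i z) T + koszul_wedge i (koszul_bd ?N var z) T = var i * z T" if "i \<in> ?N" for i T
    using koszul_bd_koszul_wedge[of ?N i var z T] that by simp
  have "koszul_bd ?N var w T = (\<Sum>i<n. g i * koszul_bd ?N var (koszul_wedge i z) T)" for T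
    unfolding w_def koszul_bd_sum koszul_bd_scale ..
  then have "koszul_bd ?N var w T + r T = (\<Sum>i<n. g i * (var i * z T))" for T
    unfolding r_def by (simp add: sum.distrib[symmetric] distrib_left[symmetric] kw)
  then have w_bd: "koszul_bd ?N var w T = f * z T - r T" for T
    unfolding g(2) sum_distrib_right by (simp add: mult.assoc eq_diff_eq)
  have rJ: "r T \<in> J" for T
    unfolding r_def using z(3) g(1) by (intro ideal_sum[OF J] ideal_mult[OF J] koszul_wedge_ideal[OF J]) auto
  have wS: "w T \<in> Spoly n" for T
    unfolding w_def using z(2) g(1)
    by (intro ideal_sum[OF is_ideal_Spoly] ideal_mult[OF is_ideal_Spoly] koszul_wedge_ideal[OF is_ideal_Spoly]) auto
  have w_chain: "koszul_chain ?N (Suc k) w"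
    unfolding koszul_chain_def
  proof (intro allI impI)
    fix T assume "w T \<noteq> 0"
    then obtain i where i: "i \<in> {..<n}" "g i * koszul_wedge i z T \<noteq> 0"
      unfolding w_def by (rule sum.not_neutral_contains_not_neutral)
    then have "koszul_wedge i z T \<noteq> 0" by auto
    then show "T \<subseteq> ?N \<and> card T = Suc k"
      using koszul_chain_koszul_wedge[OF z(1) i(1)] unfolding koszul_chain_def by blast
  qed
  have "koszul_bd ?N var w T \<in> add_gen n J f" for T
  proof -
    have "koszul_bd ?N var w T = - r T + z T * f" unfolding w_bd by (simp add: mult.commute)
    then show ?thesis unfolding add_gen_eq[OF J fS] using ideal_uminus[OF J rJ] z(2) by blast
  qed
  then obtain v where v: "koszul_chain ?N (Suc (Suc k)) v" "\<And>T. v T \<in> Spoly n"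
    "\<And>T. w T - koszul_bd ?N var v T \<in> add_gen n J f"
    using exact w_chain wS unfolding koszul_exact_def by blast
  \<comment> \<open>Choosing t as zero where the difference vanishes makes t a chain of the same
    degree as the difference.\<close>
  have "\<exists>j t. j \<in> J \<and> t \<in> Spoly n \<and> w T - koszul_bd ?N var v T = j + t * f \<and> (w T - koszul_bd ?N var v T = 0 \<longrightarrow> t = 0)" for T
  proof (cases "w T - koszul_bd ?N var v T = 0")
    case True
    then show ?thesis using ideal_0[OF J] by (intro exI[of _ 0]) simp
  next
    case False
    then show ?thesis using v(3)[of T] unfolding add_gen_eq[OF J fS] by blast
  qed
  then obtain j t where jt: "\<And>T. j T \<in> J" "\<And>T. t T \<in> Spoly n" "\<And>T. w T - koszul_bd ?N var v T = j T + t T * f"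
    "\<And>T. w T - koszul_bd ?N var v T = 0 \<Longrightarrow> t T = 0" by metis
  have t_chain: "koszul_chain ?N (Suc k) t"
    using w_chain koszul_chain_koszul_bd[OF v(1), of var] jt(4) unfolding koszul_chain_def
    by (metis diff_self finite_lessThan)
  \<comment> \<open>Taking boundaries in w - dv = j + t * f removes dv. Compared with dw = f * z -
    r, this puts (z - dt) * f into J, and f is cancelled by regularity.\<close>
  have "koszul_bd ?N var w T = koszul_bd ?N var (\<lambda>T. w T - koszul_bd ?N var v T) T" for T
    unfolding koszul_bd_diff by (simp add: koszul_bd_koszul_bd)
  also have "\<dots> T = koszul_bd ?N var j T + koszul_bd ?N var t T * f" for T
    unfolding jt(3) koszul_bd_add using koszul_bd_scale[of ?N var f t T] by (simp only: mult.commute[of _ f])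
  finally have eq: "f * z T - r T = koszul_bd ?N var j T + koszul_bd ?N var t T * f" for T
    unfolding w_bd .
  have "(z T - koszul_bd ?N var t T) * f \<in> J" for T
  proof -
    have "(z T - koszul_bd ?N var t T) * f = koszul_bd ?N var j T + r T"
      using eq[of T] by (simp add: algebra_simps)
    then show ?thesis using ideal_add[OF J koszul_bd_ideal[OF J jt(1)] rJ] by simp
  qed
  then have "z T - koszul_bd ?N var t T \<in> J" for T
    using nzd z(2) koszul_bd_ideal[OF is_ideal_Spoly jt(2)] by (simp add: Spoly_diff)
  then show "\<exists>y. koszul_chain ?N (Suc k) y \<and> (\<forall>T. y T \<in> Spoly n) \<and> (\<forall>T. z T - koszul_bd ?N var y T \<in> J)"
    using t_chain jt(2) by blast
qed

lemma ideal_gen_insert: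
  assumes "G \<subseteq> Spoly n" "u \<in> Spoly n"
  shows "ideal_gen n (insert u G) = add_gen n (ideal_gen n G) u"
proof
  have G: "is_ideal n (ideal_gen n G)" by (rule is_ideal_gen[OF assms(1)])
  have id: "is_ideal n (ideal_gen n (insert u G))" using assms by (intro is_ideal_gen) auto
  have id': "is_ideal n (add_gen n (ideal_gen n G) u)"
    unfolding add_gen_def using assms ideal_subset[OF G] by (intro is_ideal_gen) auto
  show "ideal_gen n (insert u G) \<subseteq> add_gen n (ideal_gen n G) u"
    using subset_ideal_gen[of G n] subset_ideal_gen[of "insert u (ideal_gen n G)" n]
    by (intro ideal_gen_minimal[OF id']) (auto simp: add_gen_def)
  have "ideal_gen n G \<subseteq> ideal_gen n (insert u G)"
    using subset_ideal_gen[of "insert u G" n] by (intro ideal_gen_minimal[OF id]) auto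
  then show "add_gen n (ideal_gen n G) u \<subseteq> ideal_gen n (insert u G)"
    unfolding add_gen_def using subset_ideal_gen[of "insert u G" n] by (intro ideal_gen_minimal[OF id]) auto
qed

text \<open>Descending induction along the sequence: at its end the degree exceeds n and there are
  no chains, and each element removed lowers the degree by one.\<close>

lemma regular_seq_koszul_exact:
  fixes I :: "'a::field mpoly set"
  assumes I: "is_ideal n I" and reg: "regular_seq n I fs" and "n < k + length fs"
  shows "koszul_exact n I k"
proof -
  have fs: "set fs \<subseteq> max_ideal n" using reg by (simp add: regular_seq_def)
  then have fsS: "set fs \<subseteq> Spoly n" by (auto simp: max_ideal_def)
  let ?J = "\<lambda>i. ideal_gen n (I \<union> set (take i fs))"
  have G: "I \<union> set (take i fs) \<subseteq> Spoly n" for i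
    using ideal_subset[OF I] fsS set_take_subset[of i fs] by blast
  have id: "is_ideal n (?J i)" for i by (rule is_ideal_gen[OF G])
  have "koszul_exact n (?J i) (k + i)" if "i \<le> length fs" for i
    using that
  proof (induction i rule: inc_induct)
    case base
    show ?case by (rule koszul_exact_trivial[OF id]) (use assms(3) in simp)
  next
    case (step i)
    have i: "i < length fs" using step.hyps by simp
    have mem: "fs ! i \<in> set fs" using i by simp
    show ?case
    proof (rule koszul_exact_regular[OF id])
      show "fs ! i \<in> max_ideal n" using mem fs by blast
      show "g \<in> ?J i" if "g \<in> Spoly n" "g * fs ! i \<in> ?J i" for g
        using reg that i unfolding regular_seq_def by blast
      have "I \<union> set (take (Suc i) fs) = insert (fs ! i) (I \<union> set (take i fs))"
        using i by (auto simp: take_Suc_conv_app_nth)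
      then have "?J (Suc i) = add_gen n (?J i) (fs ! i)"
        using ideal_gen_insert[OF G, of "fs ! i" i] mem fsS by auto
      then show "koszul_exact n (add_gen n (?J i) (fs ! i)) (Suc (k + i))"
        using step.IH by simp
    qed
  qed
  from this[of 0] show ?thesis by (simp add: ideal_gen_ideal[OF I])
qed

section \<open>Koszul homology in a single multidegree\<close>

lemma koszul_sign_mult_single:
  "koszul_sign j T * Poly_Mapping.single m c = Poly_Mapping.single m (koszul_sign j T * (c :: 'a::field))"
  by (simp add: koszul_sign_def minus_one_power_iff single_uminus)

lemma lookup_koszul_sign_mult: "lkp (koszul_sign j T * p) m = koszul_sign j T * lkp (p :: 'a::field mpoly) m"
  by (simp add: koszul_sign_def minus_one_power_iff)

text \<open>Scalar chains are homogenised by attaching to e_T the monomial x^b divided by the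
  variables of T. Boundaries are then homogeneous of degree b, and reading off coefficients leads
  back to scalars.\<close>

lemma koszul_exact_vanishing:
  fixes V :: "(nat \<Rightarrow> nat) set"
  assumes exact: "koszul_exact n (mono_ideal n V :: 'a::field mpoly set) 3" and b: "{i. 0 < b i} \<subseteq> {..<n}"
  shows "koszul_vanishing TYPE('a) V b"
  unfolding koszul_vanishing_def
proof (intro allI impI)
  let ?B = "{i. 0 < b i}" and ?I = "mono_ideal n V :: 'a mpoly set"
  fix y :: "nat set \<Rightarrow> 'a"
  assume y: "koszul_chain ?B 3 y"
    and cyc: "\<forall>U. U \<subseteq> ?B \<longrightarrow> card U = 2 \<longrightarrow> \<not> covered V b U \<longrightarrow> koszul_bd ?B (\<lambda>_. 1) y U = 0"
  have finB: "finite ?B" using b finite_subset by blast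
  \<comment> \<open>The truncated difference is the intended quotient for T inside
    \<open>?B\<close>, which is where y and w are supported.\<close>
  define E where "E T = Abs_poly_mapping (\<lambda>i. b i - of_bool (i \<in> T))" for T
  have lkE: "lkp (E T) i = b i - of_bool (i \<in> T)" for T i
  proof -
    have "finite {i. b i - of_bool (i \<in> T) \<noteq> 0}"
      by (rule finite_subset[OF _ finB]) auto
    then show ?thesis by (simp add: E_def)
  qed
  have keysE: "keys (E T) \<subseteq> {..<n}" for T
  proof -
    have "keys (E T) \<subseteq> ?B" by (auto simp: in_keys_iff lkE)
    then show ?thesis using b by (rule subset_trans)
  qed
  have E_insert: "E (insert j T) + Poly_Mapping.single j 1 = E T" if "j \<in> ?B" "j \<notin> T" for j T
    using that by (intro poly_mapping_eqI) (auto simp: lookup_add lkE lookup_single when_def of_bool_def)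
  have cov: "monom (E T) \<in> ?I \<longleftrightarrow> covered V b T" if "T \<subseteq> ?B" for T
  proof -
    have "v \<le> lkp (E T) \<longleftrightarrow> v \<le> b \<and> T \<subseteq> slack v b" for v
      using that unfolding le_fun_def lkE slack_def by (fastforce simp: of_bool_def split: if_splits)
    then show ?thesis using keysE by (simp add: monom_mono_ideal_iff covered_def)
  qed
  define z :: "nat set \<Rightarrow> 'a mpoly" where "z T = Poly_Mapping.single (E T) (y T)" for T
  have z_bd: "koszul_bd {..<n} var z U = Poly_Mapping.single (E U) (koszul_bd ?B (\<lambda>_. 1) y U)" for U
  proof -
    have "koszul_bd {..<n} var z U = (\<Sum>j\<in>?B - U. koszul_sign j U * var j * z (insert j U))"
      unfolding koszul_bd_def
    proof (rule sum.mono_neutral_right)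
      show "\<forall>j\<in>({..<n} - U) - (?B - U). koszul_sign j U * var j * z (insert j U) = 0"
      proof
        fix j assume "j \<in> ({..<n} - U) - (?B - U)"
        then have "\<not> insert j U \<subseteq> ?B" by auto
        then have "y (insert j U) = 0" using y unfolding koszul_chain_def by blast
        then show "koszul_sign j U * var j * z (insert j U) = 0" by (simp add: z_def)
      qed
    qed (use b in auto)
    also have "\<dots> = (\<Sum>j\<in>?B - U. Poly_Mapping.single (E U) (koszul_sign j U * 1 * y (insert j U)))"
    proof (rule sum.cong[OF refl])
      fix j assume j: "j \<in> ?B - U"
      have "var j * z (insert j U) = Poly_Mapping.single (E U) (y (insert j U))"
        using E_insert[of j U] j by (simp add: var_def monom_def z_def mult_single add.commute)
      then show "koszul_sign j U * var j * z (insert j U) = Poly_Mapping.single (E U) (koszul_sign j U * 1 * y (insert j U))"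
        by (simp add: mult.assoc koszul_sign_mult_single)
    qed
    also have "\<dots> = Poly_Mapping.single (E U) (koszul_bd ?B (\<lambda>_. 1) y U)"
      unfolding koszul_bd_def by (rule poly_mapping_eqI) (simp add: lookup_sum lookup_single when_def)
    finally show ?thesis .
  qed
  have "koszul_bd {..<n} var z U \<in> ?I" for U
  proof (cases "koszul_bd ?B (\<lambda>_. 1) y U = 0")
    case True
    then show ?thesis unfolding z_bd by (simp add: ideal_0[OF mono_ideal_ideal])
  next
    case False
    have "koszul_chain ?B 2 (koszul_bd ?B (\<lambda>_. 1) y)"
      using koszul_chain_koszul_bd[of ?B 2 y] y finB by (simp add: eval_nat_numeral)
    then have "U \<subseteq> ?B" "card U = 2" using False unfolding koszul_chain_def by blast+
    then have "monom (E U) \<in> ?I" using cyc cov False by blast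
    then show ?thesis
      unfolding z_bd
      by - (rule mono_ideal_memI_monomials[OF Spoly_single[OF keysE]], simp split: if_splits)
  qed
  moreover have "koszul_chain {..<n} 3 z"
    using y b unfolding koszul_chain_def z_def by (metis single_zero subset_trans)
  moreover have "z T \<in> Spoly n" for T unfolding z_def by (rule Spoly_single[OF keysE])
  ultimately obtain \<zeta> where zeta: "\<And>T. z T - koszul_bd {..<n} var \<zeta> T \<in> ?I"
    using exact unfolding koszul_exact_def by blast
  \<comment> \<open>\<open>\<zeta>\<close> need not be homogeneous; only its component of degree b
    is kept.\<close>
  define w where "w T = (if T \<subseteq> ?B \<and> card T = 4 then lkp (\<zeta> T) (E T) else 0)" for T
  have "y T = koszul_bd ?B (\<lambda>_. 1) w T" if T: "T \<subseteq> ?B" "card T = 3" "\<not> covered V b T" for T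
  proof -
    \<comment> \<open>A monomial ideal contains every monomial of its members, and this one lies
      outside.\<close>
    have "E T \<notin> keys (z T - koszul_bd {..<n} var \<zeta> T)"
      using mono_ideal_keys[OF zeta[of T]] cov T by blast
    then have "y T = lkp (koszul_bd {..<n} var \<zeta> T) (E T)"
      by (simp add: in_keys_iff lookup_minus z_def)
    also have "\<dots> = (\<Sum>j\<in>{..<n} - T. koszul_sign j T * lkp (var j * \<zeta> (insert j T)) (E T))"
      by (simp add: koszul_bd_def lookup_sum mult.assoc lookup_koszul_sign_mult)
    \<comment> \<open>A variable outside the support of b does not divide the monomial of
      \<open>E T\<close>, so its terms do not reach this coefficient.\<close>
    also have "\<dots> = (\<Sum>j\<in>?B - T. koszul_sign j T * lkp (var j * \<zeta> (insert j T)) (E T))"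
    proof (rule sum.mono_neutral_right)
      show "\<forall>j\<in>({..<n} - T) - (?B - T). koszul_sign j T * lkp (var j * \<zeta> (insert j T)) (E T) = 0"
      proof
        fix j assume "j \<in> ({..<n} - T) - (?B - T)"
        then have "b j = 0" by auto
        then have "lkp (E T) j = 0" by (simp add: lkE)
        then have "E T \<notin> keys (\<zeta> (insert j T) * var j)"
          by (auto simp: var_def keys_times_monom lookup_add)
        then show "koszul_sign j T * lkp (var j * \<zeta> (insert j T)) (E T) = 0"
          by (simp add: in_keys_iff mult.commute)
      qed
    qed (use b in auto)
    also have "\<dots> = (\<Sum>j\<in>?B - T. koszul_sign j T * 1 * w (insert j T))"
    proof (rule sum.cong[OF refl])
      fix j assume j: "j \<in> ?B - T"
      have "finite T" using T(1) finB finite_subset by blast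
      then have "w (insert j T) = lkp (\<zeta> (insert j T)) (E (insert j T))"
        using T j by (simp add: w_def)
      also have "\<dots> = lkp (\<zeta> (insert j T) * var j) (E (insert j T) + Poly_Mapping.single j 1)"
        unfolding var_def by (rule lookup_times_monom[symmetric])
      also have "\<dots> = lkp (var j * \<zeta> (insert j T)) (E T)"
        using E_insert[of j T] j by (simp add: mult.commute)
      finally show "koszul_sign j T * lkp (var j * \<zeta> (insert j T)) (E T) = koszul_sign j T * 1 * w (insert j T)" by simp
    qed
    finally show ?thesis by (simp add: koszul_bd_def)
  qed
  moreover have "koszul_chain ?B 4 w" by (simp add: koszul_chain_def w_def)
  ultimately show "\<exists>w. koszul_chain ?B 4 w \<and>
      (\<forall>T. T \<subseteq> ?B \<longrightarrow> card T = 3 \<longrightarrow> \<not> covered V b T \<longrightarrow> y T = koszul_bd ?B (\<lambda>_. 1) w T)" by blast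
qed

section \<open>Height and dimension\<close>

text \<open>Variables are adjoined one at a time. Starting from the empty set this bounds a height
  from below; ending with all variables it bounds a dimension.\<close>

lemma vars_chain:
  assumes "distinct xs" "set xs \<subseteq> {..<n}" "set xs \<inter> A = {}"
  defines "cs \<equiv> map (\<lambda>k. mono_ideal n (unit_vec ` (A \<union> set (take k xs))) :: 'a::field mpoly set) [0..<Suc (length xs)]"
  shows "prime_chain n cs" "length cs = Suc (length xs)"
    "hd cs = mono_ideal n (unit_vec ` A)" "last cs = mono_ideal n (unit_vec ` (A \<union> set xs))"
proof -
  have nth: "cs ! k = mono_ideal n (unit_vec ` (A \<union> set (take k xs)))" if "k \<le> length xs" for k
    using that unfolding cs_def by (subst nth_map) (simp_all del: upt_Suc)
  show len: "length cs = Suc (length xs)" by (simp add: cs_def del: upt_Suc)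
  then have "cs \<noteq> []" by auto
  show "hd cs = mono_ideal n (unit_vec ` A)"
    using nth[of 0] \<open>cs \<noteq> []\<close> by (simp add: hd_conv_nth)
  show "last cs = mono_ideal n (unit_vec ` (A \<union> set xs))"
    using nth[of "length xs"] \<open>cs \<noteq> []\<close> len by (simp add: last_conv_nth)
  have "cs ! k \<subset> cs ! Suc k" if k: "Suc k < length cs" for k
  proof
    have kl: "k < length xs" using k len by simp
    have tk: "set (take (Suc k) xs) = insert (xs ! k) (set (take k xs))"
      using kl by (simp add: take_Suc_conv_app_nth)
    show "cs ! k \<subseteq> cs ! Suc k"
      using kl by (simp add: nth tk) (intro mono_ideal_subsetI, auto)
    have "xs ! k \<in> set xs" using kl by simp
    then have x: "xs ! k < n" "xs ! k \<notin> A" using assms(2,3) by auto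
    have "xs ! k \<notin> set (take k xs)"
      using assms(1) kl by (auto simp: in_set_conv_nth nth_eq_iff_index_eq)
    then have "(var (xs ! k) :: 'a mpoly) \<notin> cs ! k"
      using kl x(2) by (auto simp: nth var_mono_ideal_iff unit_vec_le_iff) (auto simp: unit_vec_def split: if_splits)
    moreover have "(var (xs ! k) :: 'a mpoly) \<in> cs ! Suc k"
      using kl x(1) by (auto simp: nth tk var_mono_ideal_iff)
    ultimately show "cs ! k \<noteq> cs ! Suc k" by blast
  qed
  moreover have "\<forall>P\<in>set cs. prime_ideal n P"
    unfolding cs_def by (auto intro: prime_ideal_vars simp del: upt_Suc)
  ultimately show "prime_chain n cs"
    using \<open>cs \<noteq> []\<close> by (simp add: prime_chain_def)
qed

text \<open>The variables in P generate a prime inside P. It contains the ideal, since P contains a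
  variable of every generator, so minimality gives equality.\<close>

lemma monomial_min_prime:
  fixes V :: "(nat \<Rightarrow> nat) set"
  assumes supp: "\<And>v. v \<in> V \<Longrightarrow> {i. 0 < v i} \<subseteq> {..<n}"
    and P: "P \<in> min_primes n (mono_ideal n V :: 'a::field mpoly set)"
  shows "\<exists>A\<subseteq>{..<n}. P = mono_ideal n (unit_vec ` A)"
proof -
  have prime: "prime_ideal n P" and IP: "mono_ideal n V \<subseteq> P"
    and min: "\<And>Q. prime_ideal n Q \<Longrightarrow> mono_ideal n V \<subseteq> Q \<Longrightarrow> Q \<subseteq> P \<Longrightarrow> Q = P"
    using P by (auto simp: min_primes_def)
  have id: "is_ideal n P" using prime by (auto simp: prime_ideal_def proper_ideal_def)
  define A where "A = {i. i < n \<and> var i \<in> P}"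
  have "mono_ideal n (unit_vec ` A) \<subseteq> P"
    by (rule mono_ideal_least[OF id]) (use var_exponent in \<open>auto simp: A_def\<close>)
  moreover have "mono_ideal n V \<subseteq> (mono_ideal n (unit_vec ` A) :: 'a mpoly set)"
  proof (rule mono_ideal_subsetI)
    fix v assume v: "v \<in> V"
    obtain m where m: "lkp m = v" "keys m \<subseteq> {..<n}" using lookup_surj[OF supp[OF v]] by blast
    then have "monom m \<in> (mono_ideal n V :: 'a mpoly set)" using v by (auto simp: monom_mono_ideal_iff)
    then have "monom m \<in> P" using IP by blast
    then obtain k where "k < n" "0 < v k" "var k \<in> P" using prime_monom_var[OF prime] m(1) by blast
    then show "\<exists>w\<in>unit_vec ` A. w \<le> v" by (auto simp: A_def unit_vec_le_iff)
  qed
  ultimately have "mono_ideal n (unit_vec ` A) = P" using min[OF prime_ideal_vars] by simp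
  then show ?thesis by (intro exI[of _ A]) (auto simp: A_def)
qed

lemma prime_height_vars:
  assumes "A \<subseteq> {..<n}"
  shows "enat (card A) \<le> prime_height n (mono_ideal n (unit_vec ` A) :: 'a::field mpoly set)"
proof -
  have fin: "finite A" using assms finite_subset by blast
  define xs where "xs = sorted_list_of_set A"
  have xs: "distinct xs" "set xs = A" "length xs = card A" using fin by (auto simp: xs_def)
  obtain cs :: "'a mpoly set list" where "prime_chain n cs" "length cs = Suc (length xs)"
    "last cs = mono_ideal n (unit_vec ` ({} \<union> set xs))"
    using vars_chain[OF xs(1), of n "{}"] xs(2) assms by blast
  then show ?thesis
    unfolding prime_height_def xs(2) using xs(3) by (intro Sup_upper CollectI exI[of _ cs]) simp
qed

lemma krull_dim_vars:
  assumes "A \<subseteq> {..<n}" "I \<subseteq> (mono_ideal n (unit_vec ` A) :: 'a::field mpoly set)"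
  shows "enat (n - card A) \<le> krull_dim_quot n I"
proof -
  have fin: "finite A" using assms finite_subset by blast
  define xs where "xs = sorted_list_of_set ({..<n} - A)"
  have xs: "distinct xs" "set xs = {..<n} - A" "length xs = n - card A"
    using fin assms(1) by (auto simp: xs_def card_Diff_subset)
  obtain cs :: "'a mpoly set list" where "prime_chain n cs" "length cs = Suc (length xs)"
    "hd cs = mono_ideal n (unit_vec ` A)"
    using vars_chain[OF xs(1), of n A] xs(2) by blast
  then show ?thesis
    unfolding krull_dim_quot_def using assms(2) xs(3) by (intro Sup_upper CollectI exI[of _ cs]) simp
qed

lemma height_attained:
  assumes "height n I \<noteq> \<infinity>"
  obtains P where "P \<in> min_primes n I" "prime_height n P = height n I"
proof -
  let ?S = "prime_height n ` min_primes n I"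
  have "?S \<noteq> {}" using assms by (auto simp: height_def Inf_enat_def)
  then have "Inf ?S \<in> ?S" unfolding Inf_enat_def by (auto intro: LeastI)
  then show thesis using that unfolding height_def by fastforce
qed

section \<open>Primes of height at most 1\<close>

lemma prime_height_le:
  assumes "\<And>cs. prime_chain n cs \<Longrightarrow> last cs = P \<Longrightarrow> length cs \<le> Suc k"
  shows "prime_height n P \<le> enat k"
  unfolding prime_height_def using assms by (intro Sup_least) force

lemma prime_chain_last:
  assumes "prime_chain n cs" "last cs = P" "Suc 0 < length cs"
  shows "cs ! (length cs - 2) \<subset> P"
proof -
  have "cs ! (length cs - 2) \<subset> cs ! Suc (length cs - 2)"
    using assms(1,3) unfolding prime_chain_def by auto
  moreover have "Suc (length cs - 2) = length cs - 1" using assms(3) by simp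
  moreover have "cs ! (length cs - 1) = P" using assms(2,3) last_conv_nth[of cs] by force
  ultimately show ?thesis by simp
qed

lemma prime_chain_nth: "prime_chain n cs \<Longrightarrow> k < length cs \<Longrightarrow> prime_ideal n (cs ! k)"
  by (simp add: prime_chain_def)

lemma prime_contains_0: "prime_ideal n P \<Longrightarrow> 0 \<in> P"
  by (simp add: prime_ideal_def proper_ideal_def is_ideal_def)

lemma prime_height_0: "prime_height n {0} \<le> enat 0"
proof (rule prime_height_le)
  fix cs :: "'a mpoly set list" assume cs: "prime_chain n cs" "last cs = {0}"
  show "length cs \<le> Suc 0"
  proof (rule ccontr)
    assume "\<not> length cs \<le> Suc 0"
    then have "cs ! (length cs - 2) \<subset> {0}" "length cs - 2 < length cs"
      using prime_chain_last[OF cs] by auto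
    then show False using prime_contains_0[OF prime_chain_nth[OF cs(1)]] by blast
  qed
qed

lemma mono_ideal_empty: "mono_ideal n {} = {0}"
  unfolding mono_ideal_def by auto

lemma prime_ideal_0: "prime_ideal n {0 :: 'a::field mpoly}"
  using prime_ideal_vars[of n "{}", where 'a = 'a] by (simp add: mono_ideal_empty)

lemma min_primes_0:
  assumes "I \<subseteq> {0}"
  shows "{0} \<in> min_primes n I"
  using assms prime_ideal_0 prime_contains_0 unfolding min_primes_def by blast

text \<open>As x_i is not in Q, every member g * x_i of Q has g in Q again. Members of Q are thus
  divisible by all powers of x_i.\<close>

lemma prime_below_var:
  fixes Q :: "'a::field mpoly set"
  assumes "i < n" "prime_ideal n Q" "Q \<subset> mono_ideal n {unit_vec i}"
  shows "Q = {0}"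
proof -
  have id: "is_ideal n Q" using assms(2) by (auto simp: prime_ideal_def proper_ideal_def)
  have notin: "var i \<notin> Q"
  proof
    assume "var i \<in> Q"
    then have "mono_ideal n {unit_vec i} \<subseteq> Q"
      by (intro mono_ideal_least[OF id]) (auto intro: var_exponent)
    then show False using assms(3) by blast
  qed
  have "keys (Poly_Mapping.single i (1::nat)) \<subseteq> {..<n}" using assms(1) by simp
  from add_gen_mono_ideal[OF this, of "{}"] have "add_gen n (mono_ideal n {}) (var i) = (mono_ideal n {unit_vec i} :: 'a mpoly set)"
    unfolding var_def lookup_single_unit by simp
  then have eq: "mono_ideal n {unit_vec i} = {j + g * var i | j g :: 'a mpoly. j \<in> mono_ideal n {} \<and> g \<in> Spoly n}"
    unfolding add_gen_eq[OF mono_ideal_ideal Spoly_var[OF assms(1)]] by (rule sym)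
  have "N \<le> lkp m i" if "f \<in> Q" "m \<in> keys f" for N f m
    using that
  proof (induction N arbitrary: f m)
    case (Suc N)
    then have "f \<in> mono_ideal n {unit_vec i}" using assms(3) by blast
    then obtain g where g: "f = g * var i" "g \<in> Spoly n" unfolding eq mono_ideal_empty by auto
    then have "g \<in> Q" using Suc.prems(1) assms(1,2) notin Spoly_var unfolding prime_ideal_def by blast
    obtain k where "k \<in> keys g" "m = k + Poly_Mapping.single i 1"
      using Suc.prems(2) unfolding g(1) var_def keys_times_monom by blast
    then show ?case using Suc.IH[OF \<open>g \<in> Q\<close>] by (simp add: lookup_add)
  qed simp
  then have "keys f = {}" if "f \<in> Q" for f
    using that by (meson all_not_in_conv not_less_eq_eq order_refl)
  then show ?thesis using ideal_0[OF id] by auto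
qed

lemma prime_height_var:
  assumes "i < n"
  shows "prime_height n (mono_ideal n {unit_vec i} :: 'a::field mpoly set) \<le> enat 1"
proof (rule prime_height_le)
  fix cs :: "'a mpoly set list" assume cs: "prime_chain n cs" "last cs = mono_ideal n {unit_vec i}"
  show "length cs \<le> Suc 1"
  proof (rule ccontr)
    assume "\<not> length cs \<le> Suc 1"
    then have l: "2 < length cs" by simp
    then have "cs ! (length cs - 2) \<subset> mono_ideal n {unit_vec i}" using prime_chain_last[OF cs] by auto
    then have "cs ! (length cs - 2) = {0}"
      using prime_below_var[OF assms prime_chain_nth[OF cs(1)]] l by simp
    moreover have "cs ! (length cs - 3) \<subset> cs ! Suc (length cs - 3)"
      using cs(1) l unfolding prime_chain_def by auto
    moreover have "Suc (length cs - 3) = length cs - 2" using l by simp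
    ultimately have "cs ! (length cs - 3) \<subset> {0}" by simp
    moreover have "0 \<in> cs ! (length cs - 3)"
      using l by (intro prime_contains_0[OF prime_chain_nth[OF cs(1)]]) simp
    ultimately show False by blast
  qed
qed

lemma height_le: "P \<in> min_primes n I \<Longrightarrow> height n I \<le> prime_height n P"
  unfolding height_def by (rule Inf_lower) simp

text \<open>A variable dividing all generators generates a prime of height at most 1 over the ideal.
  Either this prime is minimal over it or the zero ideal is, and both contradict height 2.\<close>

lemma height_2_coprime_gens:
  fixes V :: "(nat \<Rightarrow> nat) set"
  assumes ht: "height n (mono_ideal n V :: 'a::field mpoly set) = 2"
    and supp: "\<And>v. v \<in> V \<Longrightarrow> {i. 0 < v i} \<subseteq> {..<n}"
  shows "V \<noteq> {}" "coprime_gens n V"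
proof -
  let ?I = "mono_ideal n V :: 'a mpoly set"
  have two: "\<not> (2 :: enat) \<le> enat 0" "\<not> (2 :: enat) \<le> enat 1"
    by (simp_all add: numeral_eq_enat)
  have ne: "{0} \<notin> min_primes n ?I"
    using height_le[of "{0}" n ?I] prime_height_0[of n] two(1) ht by (metis order_trans)
  show "V \<noteq> {}" using ne min_primes_0[of ?I n] by (auto simp: mono_ideal_empty)
  have "\<exists>v\<in>V. v i = 0" if i: "i < n" for i
  proof (rule ccontr)
    assume no: "\<not> (\<exists>v\<in>V. v i = 0)"
    let ?X = "mono_ideal n {unit_vec i} :: 'a mpoly set"
    have IX: "?I \<subseteq> ?X" using no by (intro mono_ideal_subsetI) (auto simp: unit_vec_le_iff)
    have prime: "prime_ideal n ?X" using prime_ideal_vars[of n "{i}", where 'a = 'a] by simp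
    have "?X \<notin> min_primes n ?I"
      using height_le[of ?X n ?I] prime_height_var[OF i, where 'a = 'a] two(2) ht by (metis order_trans)
    then obtain Q where Q: "prime_ideal n Q" "?I \<subseteq> Q" "Q \<subset> ?X"
      using prime IX unfolding min_primes_def by blast
    then have "Q = {0}" using prime_below_var[OF i] by blast
    then show False using ne min_primes_0[of ?I n] Q(2) by simp
  qed
  then show "coprime_gens n V" using supp by (auto simp: coprime_gens_def)
qed

text \<open>A minimal prime of height 2 is generated by at most two variables, so the dimension of
  S/I, and with it the depth, is at least n - 2.\<close>

lemma cohen_macaulay_koszul_exact:
  fixes V :: "(nat \<Rightarrow> nat) set"
  assumes supp: "\<And>v. v \<in> V \<Longrightarrow> {i. 0 < v i} \<subseteq> {..<n}"
    and cm: "cohen_macaulay_quot n (mono_ideal n V :: 'a::field mpoly set)"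
    and ht: "height n (mono_ideal n V :: 'a mpoly set) = 2"
  shows "koszul_exact n (mono_ideal n V :: 'a mpoly set) 3"
proof -
  let ?I = "mono_ideal n V :: 'a mpoly set"
  have depth: "depth_quot n ?I = krull_dim_quot n ?I"
    using cm by (simp add: cohen_macaulay_quot_def)
  obtain P where P: "P \<in> min_primes n ?I" "prime_height n P = height n ?I"
    by (rule height_attained[of n ?I]) (use ht in simp)
  obtain A where A: "A \<subseteq> {..<n}" "P = mono_ideal n (unit_vec ` A)"
    using monomial_min_prime[OF supp P(1)] by blast
  have "enat (card A) \<le> 2" using prime_height_vars[OF A(1), where 'a = 'a] P(2) A(2) ht by simp
  then have cardA: "card A \<le> 2" by (simp add: numeral_eq_enat)
  have "?I \<subseteq> P" using P(1) by (simp add: min_primes_def)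
  then have "enat (n - card A) \<le> depth_quot n ?I"
    unfolding depth A(2) by (rule krull_dim_vars[OF A(1)])
  moreover have "enat (n - 2) \<le> enat (n - card A)" using cardA by simp
  ultimately have dep: "enat (n - 2) \<le> depth_quot n ?I" by (rule order_trans[rotated])
  show ?thesis
  proof (cases "n < 3")
    case True
    then show ?thesis by (rule koszul_exact_trivial[OF mono_ideal_ideal])
  next
    case False
    \<comment> \<open>The depth is a supremum; if all regular sequences were shorter than n - 2, it
      would be at most n - 3, a genuine difference as n is at least 3.\<close>
    have "\<exists>fs. regular_seq n ?I fs \<and> n - 2 \<le> length fs"
    proof (rule ccontr)
      assume "\<not> (\<exists>fs. regular_seq n ?I fs \<and> n - 2 \<le> length fs)"
      then have "depth_quot n ?I \<le> enat (n - 3)"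
        unfolding depth_quot_def using False by (intro Sup_least) force
      then have "enat (n - 2) \<le> enat (n - 3)" using dep by (rule order_trans[rotated])
      then show False using False by simp
    qed
    then obtain fs where "regular_seq n ?I fs" "n - 2 \<le> length fs" by blast
    \<comment> \<open>The degree suffices because 3 + (n - 2) exceeds n.\<close>
    then show ?thesis using False by (intro regular_seq_koszul_exact[OF mono_ideal_ideal]) auto
  qed
qed

lemma cohen_macaulay_good_ideal:
  fixes V :: "(nat \<Rightarrow> nat) set"
  assumes fin: "finite V" and supp: "\<And>v. v \<in> V \<Longrightarrow> {i. 0 < v i} \<subseteq> {..<n}"
    and cm: "cohen_macaulay_quot n (mono_ideal n V :: 'a::field mpoly set)"
    and ht: "height n (mono_ideal n V :: 'a mpoly set) = 2"
  shows "good_ideal n (mono_ideal n V :: 'a mpoly set)"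
proof (rule principal_tree_good_ideal)
  show "coprime_gens n V" by (rule height_2_coprime_gens(2)[OF ht supp])
  have van: "koszul_vanishing TYPE('a) V b" if "{i. 0 < b i} \<subseteq> {..<n}" for b
    by (rule koszul_exact_vanishing[OF cohen_macaulay_koszul_exact[OF supp cm ht] that])
  show "principal_tree V"
    by (rule koszul_vanishing_principal_tree[OF fin height_2_coprime_gens(1)[OF ht supp] finite_lessThan supp van])
  show "(\<lambda>_. 0) \<notin> V"
  proof
    assume "(\<lambda>_. 0) \<in> V"
    then have "1 \<in> (mono_ideal n V :: 'a mpoly set)" by (auto simp: mono_ideal_def le_fun_def)
    then show False using cm by (simp add: cohen_macaulay_quot_def proper_ideal_def)
  qed
qed

theorem theorem5p4:
  fixes n :: nat and I :: "('a::field) mpoly set"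
  assumes "monomial_ideal n I"
    and "cohen_macaulay_quot n I"
    and "height n I = 2"
  shows "k_clean n 0 I"
proof -
  obtain V where V: "finite V" "\<And>v. v \<in> V \<Longrightarrow> {i. 0 < v i} \<subseteq> {..<n}" "I = mono_ideal n V"
    using monomial_ideal_finite[OF assms(1)] by blast
  have "good_ideal n I"
    using cohen_macaulay_good_ideal[OF V(1,2)] assms(2,3) unfolding V(3) by blast
  then show ?thesis by (simp add: good_ideal_def)
qed

end
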